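(* Let $(T,f)$ be a Hubbard tree with critical point $0$, and let $z_1$ be the characteristic point of a periodic orbit of branch points of $T$. Then the first return map of $z_1$ either permutes all the local arms at $z_1$ transitively, or it fixes the local arm to $0$ and permutes all the other local arms at $z_1$ transitively.
   Context: Trees. A tree $T$ is a finite connected (topological) graph without loops. For $x\in T$, the (global) arms of $x$ are the connected components of $T\setminus\{x\}$; a local arm at $x$ is the intersection of a global arm with a sufficiently small neighborhood of $x$; the local arm at $x$ to (or towards, pointing to) a point $y\neq x$ is the one contained in the global arm containing $y$. The point $x$ is an endpoint if it has only one arm, a branch point if it has at least three arms. $[x,y]$ is the unique closed arc connecting $x$ and $y$. Hubbard trees. A Hubbard tree is a tree $T$ with a map $f\colon T\to T$ and a distinguished point, the critical point, such that: (1) $f$ is continuous and surjective; (2) every point has at most two inverse images under $f$; (3) at every point other than the critical point, $f$ is a local homeomorphism onto its image; (4) all endpoints of $T$ are on the critical orbit; (5) the critical point is periodic or preperiodic, but not fixed; (6) (expansivity) if $x\neq y$ are branch points or points on the critical orbit, then there is $n\ge 0$ such that $f^{\circ n}([x,y])$ contains the critical point. Write $c_0=0$ for the critical point and $c_k=f^{\circ k}(0)$; $c_1$ is the critical value and $c_1\ne c_0$. Characteristic point. For a periodic orbit of branch points, the characteristic point is the unique point $z$ of the orbit for which there are two different components of $T\setminus\{z\}$ such that $c_1$ is contained in one of them, and $0$ and all other points of the orbit are in the other one (such a point exists and is unique). The first return map of a periodic point $z_1$ of exact period $n$ is $f^{\circ n}$, acting on the local arms at $z_1$ (the orbit does not contain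 $0$). *)

theory Defs
  imports "HOL-Analysis.Analysis"
begin

section \<open>Trees\<close>

text \<open>
  A topological space is represented by a subset of a Hausdorff type, with the subspace topology.
  Edges are simple paths, so that a finite graph may have multiple edges and edges that
  return to their initial vertex; trees are singled out by the absence of simple closed curves.
\<close>

definition finite_topological_graph :: "'a::t2_space set \<Rightarrow> bool" where
  "finite_topological_graph T \<longleftrightarrow>
     (\<exists>V E. finite V \<and> finite E \<and> T = V \<union> (\<Union>g\<in>E. path_image g) \<and>
        (\<forall>g\<in>E. simple_path g \<and> path_image g \<inter> V = {pathstart g, pathfinish g}) \<and>
        (\<forall>g\<in>E. \<forall>h\<in>E. g \<noteq> h \<longrightarrow> path_image g \<inter> path_image h \<subseteq> V))"

definition tree :: "'a::t2_space set \<Rightarrow> bool" where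
  "tree T \<longleftrightarrow> T \<noteq> {} \<and> finite_topological_graph T \<and> connected T \<and>
     \<not> (\<exists>g. simple_path g \<and> pathfinish g = pathstart g \<and> path_image g \<subseteq> T)"

definition closed_arc :: "'a::t2_space set \<Rightarrow> 'a \<Rightarrow> 'a \<Rightarrow> 'a set" where
  "closed_arc T x y =
     (if x = y then {x}
      else (THE A. A \<subseteq> T \<and>
              (\<exists>g. arc g \<and> pathstart g = x \<and> pathfinish g = y \<and> path_image g = A)))"

definition global_arms :: "'a::t2_space set \<Rightarrow> 'a \<Rightarrow> 'a set set" where
  "global_arms T x = components (T - {x})"

definition endpoint :: "'a::t2_space set \<Rightarrow> 'a \<Rightarrow> bool" where
  "endpoint T x \<longleftrightarrow> x \<in> T \<and> card (global_arms T x) = 1"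

text \<open>A point of a tree has only finitely many arms, so \<^const>\<open>card\<close> is the true cardinality.\<close>

definition branch_point :: "'a::t2_space set \<Rightarrow> 'a \<Rightarrow> bool" where
  "branch_point T x \<longleftrightarrow> x \<in> T \<and> card (global_arms T x) \<ge> 3"

text \<open>
  The intersection of a global arm \<open>A\<close> at \<open>x\<close> with a sufficiently small neighbourhood of \<open>x\<close> is
  meant as a germ, independent of the neighbourhood. We take this germ to be the filter
  \<open>at x within A\<close>, which is generated by the sets \<open>A \<inter> U\<close> for neighbourhoods \<open>U\<close> of \<open>x\<close>.
  A map \<open>g\<close> acts on germs by \<open>filtermap g\<close>: the germ of \<open>A\<close> is sent to the filter generated by
  the images \<open>g ` (A \<inter> U)\<close>.
\<close>

definition local_arms :: "'a::t2_space set \<Rightarrow> 'a \<Rightarrow> 'a filter set" where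
  "local_arms T x = (\<lambda>A. at x within A) ` global_arms T x"

definition local_arm_towards :: "'a::t2_space set \<Rightarrow> 'a \<Rightarrow> 'a \<Rightarrow> 'a filter" where
  "local_arm_towards T x y = at x within (connected_component_set (T - {x}) y)"


section \<open>Hubbard trees\<close>

definition forward_orbit :: "('a \<Rightarrow> 'a) \<Rightarrow> 'a \<Rightarrow> 'a set" where
  "forward_orbit f x = range (\<lambda>k. (f ^^ k) x)"

definition exact_period :: "('a \<Rightarrow> 'a) \<Rightarrow> 'a \<Rightarrow> nat \<Rightarrow> bool" where
  "exact_period f x n \<longleftrightarrow>
     n > 0 \<and> (f ^^ n) x = x \<and> (\<forall>m. 0 < m \<and> m < n \<longrightarrow> (f ^^ m) x \<noteq> x)"

locale hubbard_tree =
  fixes T :: "'a::t2_space set" and f :: "'a \<Rightarrow> 'a" and c0 :: 'a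
  assumes tree: "tree T"
    and crit_in: "c0 \<in> T"
    and cont: "continuous_on T f"
    and surj: "f ` T = T"
    and fibres: "\<And>y. y \<in> T \<Longrightarrow> finite {x \<in> T. f x = y} \<and> card {x \<in> T. f x = y} \<le> 2"
    and local_homeo: "\<And>x. x \<in> T \<Longrightarrow> x \<noteq> c0 \<Longrightarrow>
          \<exists>U g. openin (top_of_set T) U \<and> x \<in> U \<and> homeomorphism U (f ` U) f g"
    and endpoints: "\<And>x. endpoint T x \<Longrightarrow> x \<in> forward_orbit f c0"
    and crit_preperiodic: "\<exists>k l. k < l \<and> (f ^^ k) c0 = (f ^^ l) c0"
    and crit_not_fixed: "f c0 \<noteq> c0"
    and expansive: "\<And>x y. x \<noteq> y \<Longrightarrow>
          branch_point T x \<or> x \<in> forward_orbit f c0 \<Longrightarrow>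
          branch_point T y \<or> y \<in> forward_orbit f c0 \<Longrightarrow>
          \<exists>n. c0 \<in> (f ^^ n) ` closed_arc T x y"

text \<open>
  Here \<open>Z\<close> is the periodic orbit. Uniqueness of the characteristic point of an orbit is a
  theorem about Hubbard trees and is not built into the predicate.
\<close>

definition characteristic_point ::
    "'a::t2_space set \<Rightarrow> ('a \<Rightarrow> 'a) \<Rightarrow> 'a \<Rightarrow> 'a set \<Rightarrow> 'a \<Rightarrow> bool" where
  "characteristic_point T f c0 Z z \<longleftrightarrow> z \<in> Z \<and>
     (\<exists>A\<in>components (T - {z}). \<exists>B\<in>components (T - {z}).
        A \<noteq> B \<and> f c0 \<in> A \<and> insert c0 (Z - {z}) \<subseteq> B)"

definition permutes_transitively :: "('b \<Rightarrow> 'b) \<Rightarrow> 'b set \<Rightarrow> bool" where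
  "permutes_transitively \<phi> X \<longleftrightarrow>
     bij_betw \<phi> X X \<and> (\<forall>a\<in>X. \<forall>b\<in>X. \<exists>k. (\<phi> ^^ k) a = b)"

end

theory Submission imports Defs begin

text \<open>
  A path in a tree that is locally injective is injective, so \<open>f\<close> maps an arc injectively as long
  as the critical point is not in its interior. Hence the image of the local arm at \<open>x\<close> towards \<open>y\<close>
  points to \<open>f y\<close> if the critical point is not on \<open>[x, y]\<close>, and to the critical value otherwise.

  At points of the orbit other than \<open>z1\<close> the arm towards the critical value is the arm towards \<open>z1\<close>,
  so an arm pointing to the critical value or to a point of the orbit keeps this property until the
  orbit returns to \<open>z1\<close>. There it points to the critical value or to the critical point. Starting
  from the arm \<open>a0\<close> towards the critical point, whose first image points to the critical value,
  the first return map therefore sends \<open>a0\<close> to \<open>a0\<close> or to the arm \<open>a1\<close> towards the critical value.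
  By expansivity, the arc from \<open>z1\<close> to an endpoint in any arm eventually covers the critical point,
  so every arm eventually reaches \<open>a0\<close> or \<open>a1\<close>. Thus there is a single cycle if \<open>a0\<close> is sent
  to \<open>a1\<close>, and otherwise \<open>a0\<close> is fixed and all other arms lie on the cycle of \<open>a1\<close>.
\<close>

section \<open>Arcs in Hausdorff spaces\<close>

text \<open>Forgetting the parametrization turns uniqueness of arcs into an equality of sets, as
  \<open>closed_arc\<close> requires. The ends are automatically distinct, so degenerate arcs have
  to be treated separately.\<close>

definition arc_between :: "'a::t2_space set \<Rightarrow> 'a \<Rightarrow> 'a \<Rightarrow> bool" where
  "arc_between A x y \<longleftrightarrow> (\<exists>g. arc g \<and> pathstart g = x \<and> pathfinish g = y \<and> path_image g = A)"

lemma arc_betweenE: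
  assumes "arc_between A x y"
  obtains g where "continuous_on {0..1::real} g" "inj_on g {0..1}" "g 0 = x" "g 1 = y" "A = g ` {0..1}"
  using assms unfolding arc_between_def arc_def path_def pathstart_def pathfinish_def path_image_def
  by blast

lemma affine_mem_Icc: "a \<le> b \<Longrightarrow> u \<in> {0..1} \<Longrightarrow> a + u * (b - a) \<in> {a..b}" for a b u :: real
  using mult_left_le_one_le[of "b - a" u] mult_nonneg_nonneg[of u "b - a"] by auto

lemma continuous_on_reparam:
  fixes g :: "real \<Rightarrow> 'a::topological_space"
  assumes "continuous_on {a..b} g" "a \<le> b"
  shows "continuous_on {0..1} (\<lambda>u. g (a + u * (b - a)))"
    and "(\<lambda>u. g (a + u * (b - a))) ` {0..1} = g ` {a..b}"
proof -
  have img: "(\<lambda>u. a + u * (b - a)) ` {0..1} = {a..b}"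
  proof (cases "a = b")
    case False
    have "y \<in> (\<lambda>u. a + u * (b - a)) ` {0..1}" if "y \<in> {a..b}" for y
      using that False assms(2)
      by (intro image_eqI[of _ _ "(y - a) / (b - a)"]) (auto simp: field_simps)
    moreover have "a + u * (b - a) \<in> {a..b}" if "u \<in> {0..1}" for u
      using that assms(2) affine_mem_Icc[of a b u] by auto
    ultimately show ?thesis by blast
  next
    case True
    then show ?thesis by (auto intro: image_eqI[of _ _ 0])
  qed
  show "continuous_on {0..1} (\<lambda>u. g (a + u * (b - a)))"
    by (intro continuous_on_compose2[OF assms(1)] continuous_intros) (use img in auto)
  show "(\<lambda>u. g (a + u * (b - a))) ` {0..1} = g ` {a..b}"
    using img by (metis image_image)
qed

lemma arc_betweenI:
  fixes g :: "real \<Rightarrow> 'a::t2_space"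
  assumes "continuous_on {a..b} g" "inj_on g {a..b}" "a < b"
  shows "arc_between (g ` {a..b}) (g a) (g b)"
proof -
  let ?h = "\<lambda>u. g (a + u * (b - a))"
  have "inj_on ?h {0..1}"
  proof (rule inj_onI)
    fix u v :: real
    assume "u \<in> {0..1}" "v \<in> {0..1}" "?h u = ?h v"
    then have "a + u * (b - a) = a + v * (b - a)"
      using assms by (intro inj_onD[OF assms(2)] affine_mem_Icc) auto
    then show "u = v" using assms(3) by simp
  qed
  then show ?thesis
    unfolding arc_between_def arc_def path_def pathstart_def pathfinish_def path_image_def
    using continuous_on_reparam[OF assms(1)] assms(3) by (intro exI[of _ ?h]) auto
qed

lemma subarc:
  fixes g :: "real \<Rightarrow> 'a::t2_space"
  assumes "continuous_on {0..1} g" "inj_on g {0..1}" "0 \<le> s" "s < t" "t \<le> 1"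
  shows "arc_between (g ` {s..t}) (g s) (g t)"
  using assms(3-5)
  by (intro arc_betweenI continuous_on_subset[OF assms(1)] inj_on_subset[OF assms(2)]) auto

lemma arc_between_sym:
  assumes "arc_between A x y"
  shows "arc_between A y x"
proof -
  obtain g where "arc g" "pathstart g = x" "pathfinish g = y" "path_image g = A"
    using assms by (auto simp: arc_between_def)
  then show ?thesis
    unfolding arc_between_def by (intro exI[of _ "reversepath g"]) (simp add: arc_reversepath)
qed

lemma arc_between_mem: "arc_between A x y \<Longrightarrow> x \<in> A \<and> y \<in> A \<and> x \<noteq> y"
  unfolding arc_between_def using arc_distinct_ends by fastforce

lemma arc_between_compact: "arc_between A x y \<Longrightarrow> compact A"
  unfolding arc_between_def using compact_arc_image by blast

lemma arc_between_connected: "arc_between A x y \<Longrightarrow> connected A"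
  unfolding arc_between_def using connected_arc_image by blast

text \<open>A connected set with more than one point has no isolated points.\<close>

lemma arc_between_at_neq_bot:
  assumes "arc_between A x y"
  shows "at x within A \<noteq> bot"
proof
  assume "at x within A = bot"
  then have "eventually (\<lambda>_. False) (at x within A)" by simp
  then obtain U where U: "open U" "x \<in> U" "U \<inter> A \<subseteq> {x}"
    unfolding eventually_at_topological by blast
  have "A \<subseteq> U \<union> - {x}" using U by auto
  with connectedD[OF arc_between_connected[OF assms] U(1), of "- {x}"] show False
    using U arc_between_mem[OF assms] by blast
qed

lemma arc_between_join:
  assumes "arc_between A x y" "arc_between B y z" "A \<inter> B \<subseteq> {y}"
  shows "arc_between (A \<union> B) x z"
  using assms unfolding arc_between_def by (metis arc_join path_image_join pathfinish_join pathstart_join)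

lemma arc_between_loop:
  assumes "arc_between A x y" "arc_between B y x" "A \<inter> B \<subseteq> {x, y}"
  shows "\<exists>g. simple_path g \<and> pathfinish g = pathstart g \<and> path_image g = A \<union> B"
  using assms unfolding arc_between_def by (metis simple_path_join_loop path_image_join pathfinish_join pathstart_join)

lemma arc_between_image:
  assumes "arc_between A x y" "continuous_on A f" "inj_on f A"
  shows "arc_between (f ` A) (f x) (f y)"
proof -
  obtain g where g: "continuous_on {0..1::real} g" "inj_on g {0..1}" "g 0 = x" "g 1 = y" "A = g ` {0..1}"
    using assms(1) by (rule arc_betweenE)
  have "arc_between ((f \<circ> g) ` {0..1}) ((f \<circ> g) 0) ((f \<circ> g) 1)"
    using g assms by (intro arc_betweenI continuous_on_compose comp_inj_on) auto
  then show ?thesis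
    using g by (simp add: image_comp)
qed

lemma arc_between_sub:
  assumes "arc_between A x y" "w \<in> A" "w \<noteq> x"
  obtains A' where "arc_between A' x w" "A' \<subseteq> A"
proof -
  obtain g where g: "continuous_on {0..1::real} g" "inj_on g {0..1}" "g 0 = x" "g 1 = y" "A = g ` {0..1}"
    using assms(1) by (rule arc_betweenE)
  obtain t where "t \<in> {0..1}" "g t = w" using g assms by auto
  moreover from this have "t \<noteq> 0" using g assms by auto
  ultimately show ?thesis
    using subarc[OF g(1,2), of 0 t] g by (intro that[of "g ` {0..t}"]) auto
qed

text \<open>Both points have positive parameters, so the piece between them misses the start of the
  arc.\<close>

lemma arc_between_rest:
  assumes "arc_between A x y" "p \<in> A" "q \<in> A" "p \<noteq> q" "p \<noteq> x" "q \<noteq> x"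
  obtains A' where "arc_between A' p q" "A' \<subseteq> A - {x}"
proof -
  obtain g where g: "continuous_on {0..1::real} g" "inj_on g {0..1}" "g 0 = x" "g 1 = y" "A = g ` {0..1}"
    using assms(1) by (rule arc_betweenE)
  have *: "\<exists>A'. arc_between A' (g s) (g t) \<and> A' \<subseteq> A - {x}" if "0 < s" "s < t" "t \<le> 1" for s t
  proof -
    have "x \<notin> g ` {s..t}"
      using g(2,3) that by (force simp: inj_on_def)
    then show ?thesis
      using subarc[OF g(1,2), of s t] that g(5) by (intro exI[of _ "g ` {s..t}"]) auto
  qed
  obtain s t where "s \<in> {0..1}" "g s = p" "t \<in> {0..1}" "g t = q" using g assms by auto
  moreover from this have "s \<noteq> 0" "t \<noteq> 0" "s \<noteq> t" using g assms by auto
  ultimately show ?thesis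
    using *[of s t] *[of t s] that by (metis arc_between_sym atLeastAtMost_iff linorder_neqE order_le_less)
qed

lemma compact_preimage_Icc:
  fixes g :: "real \<Rightarrow> 'a::t2_space"
  assumes "continuous_on {0..1} g" "closed B" "0 \<le> a" "b \<le> 1"
  shows "compact {t \<in> {a..b}. g t \<in> B}"
proof -
  have "{t \<in> {a..b}. g t \<in> B} = {a..b} \<inter> ({0..1} \<inter> g -` B)"
    using assms(3,4) by auto
  then show ?thesis
    using continuous_closed_preimage[OF assms(1) _ assms(2)] by (metis closed_real_atLeastAtMost compact_Icc compact_Int_closed)
qed

text \<open>Plain concatenation need not be injective. Instead, \<open>A\<close> is followed only up
  to its first point on \<open>B\<close>, which exists by compactness, and \<open>B\<close> is
  followed from there.\<close>

lemma arc_between_trans: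
  assumes A: "arc_between A x y" and B: "arc_between B y z" and "x \<noteq> z"
  obtains C where "arc_between C x z" "C \<subseteq> A \<union> B"
proof -
  obtain g where g: "continuous_on {0..1::real} g" "inj_on g {0..1}" "g 0 = x" "g 1 = y" "A = g ` {0..1}"
    using A by (rule arc_betweenE)
  have "1 \<in> {t \<in> {0..1}. g t \<in> B}" using g(4) arc_between_mem[OF B] by auto
  moreover have "compact {t \<in> {0..1}. g t \<in> B}"
    using compact_preimage_Icc[OF g(1)] arc_between_compact[OF B] compact_imp_closed by auto
  ultimately obtain t where t: "t \<in> {0..1}" "g t \<in> B" "\<And>s. s \<in> {0..1} \<Longrightarrow> g s \<in> B \<Longrightarrow> t \<le> s"
    using compact_attains_inf[of "{t \<in> {0..1}. g t \<in> B}"] by blast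
  \<comment> \<open>If the first hit is \<open>x\<close> or \<open>z\<close>, one of the two pieces
    to be joined degenerates to a point.\<close>
  show ?thesis
  proof (cases "t = 0 \<or> g t = z")
    case True
    show ?thesis
    proof (cases "t = 0")
      case True
      then have "x \<in> B" using t g by auto
      then obtain C where "arc_between C z x" "C \<subseteq> B"
        using arc_between_sub[OF arc_between_sym[OF B]] \<open>x \<noteq> z\<close> by metis
      then show ?thesis using that arc_between_sym by blast
    next
      case False
      then have "arc_between (g ` {0..t}) x z"
        using True t subarc[OF g(1,2), of 0 t] g(3) by auto
      then show ?thesis using that g(5) t(1) by fastforce
    qed
  next
    case False
    then have 1: "arc_between (g ` {0..t}) x (g t)"
      using t subarc[OF g(1,2), of 0 t] g(3) by auto
    obtain D where D: "arc_between D z (g t)" "D \<subseteq> B"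
      using arc_between_sub[OF arc_between_sym[OF B], of "g t"] False t by metis
    have "g ` {0..t} \<inter> D \<subseteq> {g t}"
      using t D by (fastforce simp: image_iff)
    then have "arc_between (g ` {0..t} \<union> D) x z"
      by (rule arc_between_join[OF 1 arc_between_sym[OF D(1)]])
    moreover have "g ` {0..t} \<union> D \<subseteq> A \<union> B" using D g(5) t(1) by fastforce
    ultimately show ?thesis using that by blast
  qed
qed

section \<open>Arc-connectedness as an equivalence relation\<close>

text \<open>Admitting \<open>x = y\<close> makes the relation reflexive on \<open>S\<close>, since
  arcs have distinct ends.\<close>

definition arc_joined :: "'a::t2_space set \<Rightarrow> 'a \<Rightarrow> 'a \<Rightarrow> bool" where
  "arc_joined S x y \<longleftrightarrow> x \<in> S \<and> y \<in> S \<and> (x = y \<or> (\<exists>A\<subseteq>S. arc_between A x y))"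

lemma arc_joined_sym: "arc_joined S x y \<Longrightarrow> arc_joined S y x"
  unfolding arc_joined_def using arc_between_sym by blast

lemma arc_joined_trans: "arc_joined S x y \<Longrightarrow> arc_joined S y z \<Longrightarrow> arc_joined S x z"
  unfolding arc_joined_def
proof (intro conjI; (elim conjE)?)
  assume "x = y \<or> (\<exists>A\<subseteq>S. arc_between A x y)" "y = z \<or> (\<exists>A\<subseteq>S. arc_between A y z)"
  then show "x = z \<or> (\<exists>A\<subseteq>S. arc_between A x z)"
  proof (elim disjE exE conjE)
    fix A B assume AB: "A \<subseteq> S" "arc_between A x y" "B \<subseteq> S" "arc_between B y z"
    show ?thesis
    proof (cases "x = z")
      case False
      then obtain C where "arc_between C x z" "C \<subseteq> A \<union> B"
        using arc_between_trans AB by metis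
      then show ?thesis using AB by blast
    qed blast
  qed blast+
qed

lemma arc_joined_imp_connected_component: "arc_joined S x y \<Longrightarrow> connected_component S x y"
  unfolding arc_joined_def
  by (metis arc_between_connected arc_between_mem connected_component_def connected_component_refl)

text \<open>
  Being arc-joined is an equivalence relation, each of whose classes is a union of finitely many
  pieces, hence closed in \<open>S\<close>; so a connected set meets only one class.
\<close>

lemma connected_component_eq_arc_joined:
  fixes S T :: "'a::t2_space set"
  assumes "finite Qs" and "\<And>Q. Q \<in> Qs \<Longrightarrow> compact Q" and "S \<subseteq> \<Union>Qs"
    and joined: "\<And>Q p q. Q \<in> Qs \<Longrightarrow> p \<in> Q \<inter> S \<Longrightarrow> q \<in> Q \<inter> S \<Longrightarrow> arc_joined S p q"
  shows "connected_component S x y \<longleftrightarrow> arc_joined S x y"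
proof
  assume xy: "connected_component S x y"
  then obtain K where K: "connected K" "K \<subseteq> S" "x \<in> K" "y \<in> K"
    unfolding connected_component_def by blast
  \<comment> \<open>The union of the pieces that contain a point of \<open>S\<close> with property
    \<open>P\<close>. It is closed, and if \<open>P\<close> is constant on classes, it meets
    \<open>S\<close> exactly in the points satisfying \<open>P\<close>.\<close>
  define F where "F P = \<Union>{Q \<in> Qs. \<exists>p \<in> Q \<inter> S. P p}" for P
  have cl: "closed (F P)" for P
    unfolding F_def using assms(1,2) by (intro closed_Union) (auto intro: compact_imp_closed)
  have F: "p \<in> F P \<longleftrightarrow> P p" if P: "\<And>p q. arc_joined S p q \<Longrightarrow> P p \<longleftrightarrow> P q" and "p \<in> S" for P p
    unfolding F_def using that assms(3) joined by blast
  have "p \<in> F (arc_joined S x) \<longleftrightarrow> arc_joined S x p" "p \<in> F (\<lambda>q. \<not> arc_joined S x q) \<longleftrightarrow> \<not> arc_joined S x p"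
    if "p \<in> S" for p
    using that by (intro F; meson arc_joined_sym arc_joined_trans)+
  moreover have "arc_joined S x x" using K by (auto simp: arc_joined_def)
  ultimately show "arc_joined S x y"
    using connected_closedD[OF K(1) _ _ cl cl, of "arc_joined S x" "\<lambda>q. \<not> arc_joined S x q"] K
    by blast
qed (rule arc_joined_imp_connected_component)

section \<open>Arcs and arms in trees\<close>

text \<open>An edge whose ends coincide would be a simple closed curve, so in a tree all edges are
  arcs.\<close>

lemma tree_edges:
  assumes "tree T"
  obtains V E where "finite V" "finite E" "T = V \<union> (\<Union>g\<in>E. path_image g)"
    "\<And>g. g \<in> E \<Longrightarrow> arc g" "\<And>g. g \<in> E \<Longrightarrow> pathstart g \<in> V" "\<And>g. g \<in> E \<Longrightarrow> pathfinish g \<in> V"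
proof -
  obtain V E where VE: "finite V" "finite E" "T = V \<union> (\<Union>g\<in>E. path_image g)"
    and sp: "\<And>g. g \<in> E \<Longrightarrow> simple_path g"
    and e: "\<And>g. g \<in> E \<Longrightarrow> path_image g \<inter> V = {pathstart g, pathfinish g}"
    using assms unfolding tree_def finite_topological_graph_def by metis
  have "arc g" if "g \<in> E" for g
  proof -
    have "path_image g \<subseteq> T" using VE that by auto
    then have "pathfinish g \<noteq> pathstart g" using assms sp[OF that] unfolding tree_def by blast
    then show ?thesis using sp[OF that] simple_path_imp_arc by blast
  qed
  then show ?thesis using VE e by (intro that[of V E]) auto
qed

text \<open>After cutting at \<open>x\<close>, the point \<open>x\<close> can only be the start of a
  piece, and each piece still terminates at an end of the original arc.\<close>

lemma arc_split_at:
  assumes "arc_between A u v"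
  shows "\<exists>Qs. finite Qs \<and> \<Union>Qs = A \<and>
    (\<forall>Q\<in>Qs. \<exists>a b. b \<in> {u, v} \<and> arc_between Q a b \<and> (x \<in> Q \<longrightarrow> x = a))"
proof -
  obtain g where g: "continuous_on {0..1::real} g" "inj_on g {0..1}" "g 0 = u" "g 1 = v" "A = g ` {0..1}"
    using assms(1) by (rule arc_betweenE)
  consider "x \<notin> A \<or> x = u" | "x = v" | s where "0 < s" "s < 1" "x = g s"
  proof (cases "x \<in> A")
    case True
    then obtain s where "x = g s" "0 \<le> s" "s \<le> 1" using g(5) by auto
    then show ?thesis using that(1,2) that(3)[of s] g(3,4) by (cases "s = 0"; cases "s = 1") auto
  qed (use that in blast)
  then show ?thesis
  proof cases
    case 1
    then show ?thesis using assms by (intro exI[of _ "{A}"]) auto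
  next
    case 2
    then show ?thesis using arc_between_sym[OF assms] by (intro exI[of _ "{A}"]) auto
  next
    case 3
    then have "arc_between (g ` {0..s}) x u" "arc_between (g ` {s..1}) x v"
      using subarc[OF g(1,2), of 0 s] subarc[OF g(1,2), of s 1] g by (auto intro: arc_between_sym)
    moreover have "g ` {0..s} \<union> g ` {s..1} = A"
      using g(5) 3 by (force simp: image_Un[symmetric] ivl_disj_un)
    ultimately show ?thesis by (intro exI[of _ "{g ` {0..s}, g ` {s..1}}"]) auto
  qed
qed

text \<open>The finite set \<open>V\<close> is chosen before \<open>x\<close>, so that one set
  serves all base points; the induction in \<open>component_contains_endpoint\<close> relies on
  this.\<close>

lemma tree_pieces:
  assumes "tree T"
  obtains V where "finite V" "V \<subseteq> T"
    "\<And>x. \<exists>Qs. finite Qs \<and> \<Union>Qs = T \<and>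
      (\<forall>Q\<in>Qs. (\<exists>v\<in>V. Q = {v}) \<or> (\<exists>u v. v \<in> V \<and> arc_between Q u v \<and> (x \<in> Q \<longrightarrow> x = u)))"
proof -
  obtain V E where VE: "finite V" "finite E" "T = V \<union> (\<Union>g\<in>E. path_image g)"
    and g: "\<And>g. g \<in> E \<Longrightarrow> arc g" "\<And>g. g \<in> E \<Longrightarrow> pathstart g \<in> V" "\<And>g. g \<in> E \<Longrightarrow> pathfinish g \<in> V"
    using tree_edges[OF assms] by metis
  have "\<exists>Qs. finite Qs \<and> \<Union>Qs = T \<and>
      (\<forall>Q\<in>Qs. (\<exists>v\<in>V. Q = {v}) \<or> (\<exists>u v. v \<in> V \<and> arc_between Q u v \<and> (x \<in> Q \<longrightarrow> x = u)))" for x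
  proof -
    have "\<forall>g\<in>E. \<exists>Qs. finite Qs \<and> \<Union>Qs = path_image g \<and>
       (\<forall>Q\<in>Qs. \<exists>a b. b \<in> V \<and> arc_between Q a b \<and> (x \<in> Q \<longrightarrow> x = a))"
    proof
      fix h assume h: "h \<in> E"
      have "arc_between (path_image h) (pathstart h) (pathfinish h)"
        using g(1)[OF h] by (auto simp: arc_between_def)
      from arc_split_at[OF this, of x] g(2,3)[OF h]
      show "\<exists>Qs. finite Qs \<and> \<Union>Qs = path_image h \<and>
       (\<forall>Q\<in>Qs. \<exists>a b. b \<in> V \<and> arc_between Q a b \<and> (x \<in> Q \<longrightarrow> x = a))"
        by (metis insert_iff singletonD)
    qed
    then obtain R where R: "\<And>g. g \<in> E \<Longrightarrow> finite (R g)" "\<And>g. g \<in> E \<Longrightarrow> \<Union>(R g) = path_image g"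
      "\<And>g Q. g \<in> E \<Longrightarrow> Q \<in> R g \<Longrightarrow> \<exists>a b. b \<in> V \<and> arc_between Q a b \<and> (x \<in> Q \<longrightarrow> x = a)"
      by metis
    show ?thesis
    proof (intro exI conjI ballI)
      let ?Qs = "(\<lambda>v. {v}) ` V \<union> (\<Union>g\<in>E. R g)"
      show "finite ?Qs" using VE R by blast
      have "\<Union>(\<Union>g\<in>E. R g) = (\<Union>g\<in>E. \<Union>(R g))" by blast
      also have "\<dots> = (\<Union>g\<in>E. path_image g)" using R(2) by simp
      finally show "\<Union>?Qs = T" using VE(3) by auto
      show "(\<exists>v\<in>V. Q = {v}) \<or> (\<exists>u v. v \<in> V \<and> arc_between Q u v \<and> (x \<in> Q \<longrightarrow> x = u))" if "Q \<in> ?Qs" for Q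
        using that R(3) by blast
    qed
  qed
  then show ?thesis using VE by (intro that[of V]) auto
qed

locale tree_space =
  fixes T :: "'a::t2_space set"
  assumes tree: "tree T"
begin

text \<open>Since \<open>x\<close> can only be an end of the piece, deleting it does not disconnect
  the piece.\<close>

lemma arc_joined_compl:
  assumes Q: "(\<exists>v. Q = {v}) \<or> (\<exists>u v. arc_between Q u v \<and> (x \<in> Q \<longrightarrow> x = u))" and "Q \<subseteq> T"
    and "p \<in> Q - {x}" "q \<in> Q - {x}"
  shows "arc_joined (T - {x}) p q"
proof (cases "p = q")
  case False
  then obtain u v where uv: "arc_between Q u v" "x \<in> Q \<longrightarrow> x = u" using assms by auto
  have "\<exists>A\<subseteq>Q - {x}. arc_between A p q"
  proof (cases "p = u")
    case True
    then obtain A where "arc_between A p q" "A \<subseteq> Q"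
      using arc_between_sub[OF uv(1), of q] assms False by blast
    moreover have "x \<notin> Q" using True assms uv by auto
    ultimately show ?thesis by auto
  next
    case pu: False
    show ?thesis
    proof (cases "q = u")
      case True
      then obtain A where "arc_between A q p" "A \<subseteq> Q"
        using arc_between_sub[OF uv(1), of p] assms False by blast
      moreover have "x \<notin> Q" using True assms uv by auto
      ultimately show ?thesis using arc_between_sym by blast
    next
      case qu: False
      then obtain A where "arc_between A p q" "A \<subseteq> Q - {u}"
        using arc_between_rest[OF uv(1), of p q] assms False pu by blast
      then show ?thesis using uv by auto
    qed
  qed
  then show ?thesis using assms unfolding arc_joined_def by blast
qed (use assms in \<open>auto simp: arc_joined_def\<close>)

text \<open>The pieces cut at \<open>x\<close> stay arc-joined after \<open>x\<close> is deleted, so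
  classes are closed in \<open>T - {x}\<close>. From here on, arms can be studied through
  arcs.\<close>

lemma connected_component_iff:
  "connected_component (T - {x}) p q \<longleftrightarrow> arc_joined (T - {x}) p q"
proof -
  obtain V where V: "\<exists>Qs. finite Qs \<and> \<Union>Qs = T \<and>
      (\<forall>Q\<in>Qs. (\<exists>v\<in>V. Q = {v}) \<or> (\<exists>u v. v \<in> V \<and> arc_between Q u v \<and> (x \<in> Q \<longrightarrow> x = u)))"
    using tree_pieces[OF tree] by metis
  then obtain Qs where Qs: "finite Qs" "\<Union>Qs = T"
    "\<And>Q. Q \<in> Qs \<Longrightarrow> (\<exists>v\<in>V. Q = {v}) \<or> (\<exists>u v. v \<in> V \<and> arc_between Q u v \<and> (x \<in> Q \<longrightarrow> x = u))" by blast
  show ?thesis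
  proof (rule connected_component_eq_arc_joined[OF Qs(1)])
    show "compact Q" if "Q \<in> Qs" for Q
      using Qs(3)[OF that] arc_between_compact by auto
    show "arc_joined (T - {x}) p q"
      if "Q \<in> Qs" "p \<in> Q \<inter> (T - {x})" "q \<in> Q \<inter> (T - {x})" for Q p q
      by (rule arc_joined_compl[of Q]) (use Qs(2) Qs(3)[OF that(1)] that in blast)+
  qed (use Qs in auto)
qed

lemma connected_T: "connected T"
  using tree unfolding tree_def by blast

lemma arc_exists:
  assumes "x \<in> T" "y \<in> T" "x \<noteq> y"
  obtains A where "arc_between A x y" "A \<subseteq> T"
proof -
  obtain V where V: "\<exists>Qs. finite Qs \<and> \<Union>Qs = T \<and>
      (\<forall>Q\<in>Qs. (\<exists>v\<in>V. Q = {v}) \<or> (\<exists>u v. v \<in> V \<and> arc_between Q u v \<and> (x \<in> Q \<longrightarrow> x = u)))"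
    using tree_pieces[OF tree] by metis
  then obtain Qs where Qs: "finite Qs" "\<Union>Qs = T"
    "\<And>Q. Q \<in> Qs \<Longrightarrow> (\<exists>v\<in>V. Q = {v}) \<or> (\<exists>u v. v \<in> V \<and> arc_between Q u v \<and> (x \<in> Q \<longrightarrow> x = u))" by blast
  have "connected_component T x y \<longleftrightarrow> arc_joined T x y"
  proof (rule connected_component_eq_arc_joined[OF Qs(1)])
    show "compact Q" if "Q \<in> Qs" for Q
      using Qs(3)[OF that] arc_between_compact by auto
    show "arc_joined T p q" if Q: "Q \<in> Qs" and pq: "p \<in> Q \<inter> T" "q \<in> Q \<inter> T" for Q p q
    proof (cases "p = q")
      case False
      then obtain u v where uv: "arc_between Q u v" using Qs(3)[OF Q] pq by auto
      have *: "\<exists>A\<subseteq>Q. arc_between A a u" if "a \<in> Q" "a \<noteq> u" for a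
        using arc_between_sub[OF uv, of a] that arc_between_sym by metis
      have "Q \<subseteq> T" using Qs Q by auto
      then have "arc_joined T a u" if "a \<in> Q" for a
        using *[of a] that arc_between_mem[OF uv] unfolding arc_joined_def by blast
      then show ?thesis using pq arc_joined_sym arc_joined_trans by blast
    qed (use pq in \<open>auto simp: arc_joined_def\<close>)
  qed (use Qs in auto)
  moreover have "connected_component T x y"
    using connected_T assms unfolding connected_component_def by blast
  ultimately show ?thesis using that assms unfolding arc_joined_def by blast
qed

section \<open>Uniqueness of arcs in a tree\<close>

lemma no_loop:
  assumes "arc_between A x y" "arc_between B x y" "A \<inter> B \<subseteq> {x, y}" "A \<subseteq> T" "B \<subseteq> T"
  shows False
  using arc_between_loop[OF assms(1) arc_between_sym[OF assms(2)] assms(3)] tree assms(4,5)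
  unfolding tree_def by (metis Un_least)

text \<open>A point of \<open>A\<close> off \<open>B\<close> lies on a maximal excursion of
  \<open>A\<close> away from \<open>B\<close>. Closing it up with the part of \<open>B\<close>
  between its ends would give a simple closed curve.\<close>

lemma arc_subset:
  assumes A: "arc_between A x y" "A \<subseteq> T" and B: "arc_between B x y" "B \<subseteq> T"
  shows "A \<subseteq> B"
proof
  fix p assume "p \<in> A"
  show "p \<in> B"
  proof (rule ccontr)
    assume "p \<notin> B"
    obtain g where g: "continuous_on {0..1::real} g" "inj_on g {0..1}" "g 0 = x" "g 1 = y" "A = g ` {0..1}"
      using A(1) by (rule arc_betweenE)
    obtain t where t: "t \<in> {0..1}" "p = g t" using \<open>p \<in> A\<close> g by auto
    have cB: "closed B" using arc_between_compact[OF B(1)] compact_imp_closed by blast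
    have "0 \<in> {s \<in> {0..t}. g s \<in> B}" "1 \<in> {s \<in> {t..1}. g s \<in> B}"
      using g t arc_between_mem[OF B(1)] by auto
    moreover have "compact {s \<in> {0..t}. g s \<in> B}" "compact {s \<in> {t..1}. g s \<in> B}"
      using compact_preimage_Icc[OF g(1) cB] t by auto
    ultimately obtain a b where a: "a \<in> {0..t}" "g a \<in> B" "\<And>s. s \<in> {0..t} \<Longrightarrow> g s \<in> B \<Longrightarrow> s \<le> a"
      and b: "b \<in> {t..1}" "g b \<in> B" "\<And>s. s \<in> {t..1} \<Longrightarrow> g s \<in> B \<Longrightarrow> b \<le> s"
      using compact_attains_sup[of "{s \<in> {0..t}. g s \<in> B}"] compact_attains_inf[of "{s \<in> {t..1}. g s \<in> B}"]
      by blast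
    have ab: "a < t" "t < b" using a b t \<open>p \<notin> B\<close> by (auto simp: order_le_less)
    have 1: "arc_between (g ` {a..b}) (g a) (g b)"
      using subarc[OF g(1,2), of a b] a b ab by auto
    have "g ` {a..b} \<inter> B \<subseteq> {g a, g b}"
    proof
      fix q assume q: "q \<in> g ` {a..b} \<inter> B"
      then obtain s where s: "s \<in> {a..b}" "q = g s" by auto
      then have "s = a \<or> s = b"
        using a(1) b(1) a(3)[of s] b(3)[of s] q by (cases "s \<le> t") auto
      then show "q \<in> {g a, g b}" using s by auto
    qed
    \<comment> \<open>\<open>arc_between_rest\<close> covers only points other than the start
      \<open>x\<close> of \<open>B\<close>, so an excursion with end \<open>x\<close> is treated
      separately.\<close>
    moreover have "\<exists>D\<subseteq>B. arc_between D (g a) (g b)"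
    proof (cases "g a = x")
      case True
      then show ?thesis using arc_between_sub[OF B(1) b(2)] arc_between_mem[OF 1] by metis
    next
      case ax: False
      have "g a \<noteq> g b" using arc_between_mem[OF 1] by auto
      show ?thesis
      proof (cases "g b = x")
        case True
        then show ?thesis using arc_between_sub[OF B(1) a(2)] ax arc_between_sym by metis
      next
        case False
        then show ?thesis using arc_between_rest[OF B(1) a(2) b(2) \<open>g a \<noteq> g b\<close> ax] by (metis Diff_subset order_trans)
      qed
    qed
    ultimately show False
      using no_loop[OF 1] A(2) B(2) g(5) a b
      by (smt (verit) Int_mono atLeastAtMost_iff image_mono order_trans atLeastatMost_subset_iff order_refl)
  qed
qed

lemma arc_unique:
  "arc_between A x y \<Longrightarrow> A \<subseteq> T \<Longrightarrow> arc_between B x y \<Longrightarrow> B \<subseteq> T \<Longrightarrow> A = B"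
  by (simp add: arc_subset subset_antisym)

lemma closed_arc_eq:
  assumes "arc_between A x y" "A \<subseteq> T"
  shows "closed_arc T x y = A"
proof -
  have "(THE A. A \<subseteq> T \<and> (\<exists>g. arc g \<and> pathstart g = x \<and> pathfinish g = y \<and> path_image g = A)) = A"
    using assms arc_unique[OF _ _ assms] unfolding arc_between_def[symmetric]
    by (intro the_equality) blast+
  then show ?thesis
    using arc_between_mem[OF assms(1)] by (simp add: closed_arc_def)
qed

lemma arc_joined_along:
  assumes "arc_between A x y" "A \<subseteq> T" "w \<in> A" "w \<noteq> x"
  shows "arc_joined (T - {x}) y w"
proof (cases "w = y")
  case True
  then show ?thesis using assms by (auto simp: arc_joined_def)
next
  case False
  have y: "y \<in> A" "y \<noteq> x" using arc_between_mem[OF assms(1)] by auto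
  obtain A' where "arc_between A' y w" "A' \<subseteq> A - {x}"
    using arc_between_rest[OF assms(1) y(1) assms(3)] False y assms(4) by metis
  then show ?thesis using assms y unfolding arc_joined_def by blast
qed

lemma arc_joined_or_through:
  assumes "arc_between A p q" "A \<subseteq> T" "\<not> arc_joined (T - {x}) p q"
  shows "x \<in> A"
  using assms arc_between_mem[OF assms(1)] unfolding arc_joined_def by blast

section \<open>Local arms as germs of arcs\<close>

lemma local_arm_cong:
  assumes "arc_joined (T - {x}) y w"
  shows "local_arm_towards T x y = local_arm_towards T x w"
  using assms connected_component_eq[of w "T - {x}" y] connected_component_iff
  by (simp add: local_arm_towards_def)

text \<open>Only finitely many pieces come near \<open>x\<close>, and those entering the arm of
  \<open>y\<close> start along \<open>A\<close>. Hence the germ of an arm is the germ of any arc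
  into it, and images of arms can be computed from images of arcs.\<close>

lemma local_arm_eq_at_within:
  assumes A: "arc_between A x y" "A \<subseteq> T"
  shows "local_arm_towards T x y = at x within A"
proof -
  define C where "C = connected_component_set (T - {x}) y"
  have C: "p \<in> C \<longleftrightarrow> arc_joined (T - {x}) y p" for p
    by (simp add: C_def connected_component_iff)
  have x: "x \<in> A" "x \<noteq> y" "y \<in> A" using arc_between_mem[OF A(1)] by auto
  obtain V where V: "\<exists>Qs. finite Qs \<and> \<Union>Qs = T \<and>
      (\<forall>Q\<in>Qs. (\<exists>v\<in>V. Q = {v}) \<or> (\<exists>u v. v \<in> V \<and> arc_between Q u v \<and> (x \<in> Q \<longrightarrow> x = u)))"
    using tree_pieces[OF tree] by metis
  then obtain Qs where Qs: "finite Qs" "\<Union>Qs = T"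
    "\<And>Q. Q \<in> Qs \<Longrightarrow> (\<exists>v\<in>V. Q = {v}) \<or> (\<exists>u v. v \<in> V \<and> arc_between Q u v \<and> (x \<in> Q \<longrightarrow> x = u))" by blast
  \<comment> \<open>One neighbourhood per piece; they are intersected at the end. Pieces away from
    \<open>x\<close> are avoided by closedness, and pieces from \<open>x\<close> into other arms are
    disjoint from \<open>C\<close>.\<close>
  have "\<exists>N. open N \<and> x \<in> N \<and> N \<inter> Q \<inter> C \<subseteq> A" if Q: "Q \<in> Qs" for Q
  proof (cases "x \<in> Q")
    case False
    have "closed Q" using Qs(3)[OF Q] arc_between_compact compact_imp_closed by auto
    then show ?thesis using False by (intro exI[of _ "- Q"]) auto
  next
    case xQ: True
    consider "Q = {x}" | v where "arc_between Q x v" using Qs(3)[OF Q] xQ by blast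
    then show ?thesis
    proof cases
      case 1
      then show ?thesis using x by (intro exI[of _ UNIV]) auto
    next
      case 2
      have QT: "Q \<subseteq> T" using Qs Q by auto
      have joined: "arc_joined (T - {x}) v p" if "p \<in> Q" "p \<noteq> x" for p
        using arc_joined_along[OF 2 QT that] .
      show ?thesis
      proof (cases "v \<in> C")
        case False
        have "p \<notin> C" if "p \<in> Q" for p
          using joined[OF that] False C arc_joined_sym arc_joined_trans
          by (metis Diff_iff arc_joined_def singletonI)
        then show ?thesis by (intro exI[of _ UNIV]) auto
      next
        case True
        \<comment> \<open>Two arcs from \<open>x\<close> into the same arm share an initial segment, as otherwise they could be
          joined through \<open>x\<close> as well as inside the arm.\<close>
        obtain w where w: "w \<in> Q" "w \<in> A" "w \<noteq> x"
        proof (rule ccontr)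
          assume "\<not> thesis"
          then have QA: "Q \<inter> A \<subseteq> {x}" using that by auto
          have "v \<noteq> y" using QA x arc_between_mem[OF 2] by blast
          then obtain D where D: "D \<subseteq> T - {x}" "arc_between D v y"
            using True C arc_joined_sym[of "T - {x}" y v] unfolding arc_joined_def by blast
          have "Q \<union> A = D"
            using arc_unique[OF arc_between_join[OF arc_between_sym[OF 2] A(1) QA] _ D(2)] D(1) QT A(2) by blast
          then show False using D(1) x by blast
        qed
        obtain g where g: "continuous_on {0..1::real} g" "inj_on g {0..1}" "g 0 = x" "g 1 = v" "Q = g ` {0..1}"
          using 2 by (rule arc_betweenE)
        obtain s where s: "s \<in> {0..1}" "w = g s" using w g(5) by auto
        have "0 < s" using s w g(3) by (cases "s = 0") auto
        then have a: "arc_between (g ` {0..s}) x w" using subarc[OF g(1,2), of 0 s] s g(3) by auto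
        obtain A' where A': "arc_between A' x w" "A' \<subseteq> A"
          using arc_between_sub[OF A(1) w(2,3)] .
        have "g ` {0..s} \<subseteq> A"
        proof -
          have "g ` {0..s} \<subseteq> T" using QT g(5) s(1) by auto
          moreover have "A' \<subseteq> T" using A'(2) A(2) by blast
          ultimately have "g ` {0..s} \<subseteq> A'" using arc_subset[OF a _ A'(1)] by blast
          then show ?thesis using A'(2) by blast
        qed
        moreover have "closed (g ` {s..1})"
          using \<open>0 < s\<close> s(1)
          by (intro compact_imp_closed compact_continuous_image continuous_on_subset[OF g(1)]) auto
        moreover have "x \<notin> g ` {s..1}"
          using g(2,3) \<open>0 < s\<close> s(1) by (force simp: inj_on_def)
        moreover have "p \<in> A" if "p \<in> Q" "p \<notin> g ` {s..1}" for p
        proof -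
          obtain r where "r \<in> {0..1}" "p = g r" using \<open>p \<in> Q\<close> unfolding g(5) by blast
          then show ?thesis using that \<open>g ` {0..s} \<subseteq> A\<close> by (cases "r \<le> s") auto
        qed
        ultimately show ?thesis by (intro exI[of _ "- g ` {s..1}"]) auto
      qed
    qed
  qed
  then obtain N where N: "\<And>Q. Q \<in> Qs \<Longrightarrow> open (N Q)" "\<And>Q. Q \<in> Qs \<Longrightarrow> x \<in> N Q"
    "\<And>Q. Q \<in> Qs \<Longrightarrow> N Q \<inter> Q \<inter> C \<subseteq> A" by metis
  define M where "M = (\<Inter>Q\<in>Qs. N Q)"
  have "open M" "x \<in> M" using N Qs(1) by (auto simp: M_def)
  moreover have "M \<inter> C \<subseteq> A"
  proof
    fix p assume p: "p \<in> M \<inter> C"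
    then have "p \<in> T" using C by (auto simp: arc_joined_def)
    then obtain Q where "Q \<in> Qs" "p \<in> Q" using Qs(2) by auto
    then show "p \<in> A" using p N(3)[of Q] by (auto simp: M_def)
  qed
  moreover have "A - {x} \<subseteq> C" using arc_joined_along[OF A] C by blast
  ultimately have "at x within C = at x within A"
    by (intro at_within_nhd[of x M]) auto
  then show ?thesis by (simp add: local_arm_towards_def C_def)
qed

lemma local_arm_along:
  assumes "arc_between A x y" "A \<subseteq> T" "w \<in> A" "w \<noteq> x"
  shows "local_arm_towards T x w = local_arm_towards T x y"
  using arc_joined_along[OF assms] by (simp add: local_arm_cong)

lemma local_arm_neq_bot:
  assumes "x \<in> T" "y \<in> T" "x \<noteq> y"
  shows "local_arm_towards T x y \<noteq> bot"
proof -
  obtain A where "arc_between A x y" "A \<subseteq> T" using arc_exists[OF assms] .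
  then show ?thesis using local_arm_eq_at_within arc_between_at_neq_bot by metis
qed

lemma local_arm_towards_in_local_arms:
  assumes "y \<in> T" "x \<noteq> y"
  shows "local_arm_towards T x y \<in> local_arms T x"
  using assms unfolding local_arm_towards_def local_arms_def global_arms_def
  by (intro imageI) (auto simp: components_def)

section \<open>Endpoints in every arm\<close>

text \<open>Walking outwards: choose a vertex \<open>e\<close> in the arm. If \<open>e\<close> is
  not an endpoint, some arm at \<open>e\<close> does not contain \<open>x\<close>; it lies in the
  given arm and has fewer vertices, because \<open>e\<close> is lost.\<close>

lemma component_contains_endpoint:
  assumes "x \<in> T" "p \<in> T - {x}"
  shows "\<exists>e. arc_joined (T - {x}) p e \<and> endpoint T e"
proof -
  obtain V where V: "finite V" "V \<subseteq> T" and pieces: "\<And>x. \<exists>Qs. finite Qs \<and> \<Union>Qs = T \<and>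
      (\<forall>Q\<in>Qs. (\<exists>v\<in>V. Q = {v}) \<or> (\<exists>u v. v \<in> V \<and> arc_between Q u v \<and> (x \<in> Q \<longrightarrow> x = u)))"
    using tree_pieces[OF tree] by metis
  have meets: "\<exists>v\<in>V. arc_joined (T - {x}) p v" if p: "p \<in> T - {x}" for x p
  proof -
    obtain Qs where Qs: "\<Union>Qs = T" and Q1: "\<And>Q. Q \<in> Qs \<Longrightarrow>
        (\<exists>v\<in>V. Q = {v}) \<or> (\<exists>u v. v \<in> V \<and> arc_between Q u v \<and> (x \<in> Q \<longrightarrow> x = u))"
      using pieces[of x] by metis
    then obtain Q where Q: "Q \<in> Qs" "p \<in> Q" using p by auto
    from Q1[OF Q(1)] show ?thesis
    proof (elim disjE exE bexE conjE)
      fix v assume "v \<in> V" "Q = {v}"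
      then show ?thesis using p Q V by (auto simp: arc_joined_def)
    next
      fix u v assume v: "v \<in> V" "arc_between Q u v" "x \<in> Q \<longrightarrow> x = u"
      then have "arc_joined (T - {x}) p v"
        using Q p Qs arc_between_mem[OF v(2)] by (intro arc_joined_compl[of Q]) auto
      then show ?thesis using v by blast
    qed
  qed
  show ?thesis
    using assms
  proof (induction "card {v \<in> V. arc_joined (T - {x}) p v}" arbitrary: x p rule: less_induct)
    case less
    obtain e where e: "e \<in> V" "arc_joined (T - {x}) p e" using meets[OF less.prems(2)] by blast
    then have eT: "e \<in> T" "e \<noteq> x" by (auto simp: arc_joined_def)
    \<comment> \<open>Either \<open>T - {e}\<close> is a single arm, that of \<open>x\<close>, or
      \<open>q\<close> represents a further arm at \<open>e\<close>.\<close>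
    show ?case
    proof (cases "\<forall>q\<in>T - {e}. arc_joined (T - {e}) x q")
      case True
      then have eq: "connected_component_set (T - {e}) q = connected_component_set (T - {e}) x" if "q \<in> T - {e}" for q
        using that connected_component_iff connected_component_eq[of q "T - {e}" x] by simp
      have x: "x \<in> T - {e}" using less.prems eT by simp
      have "components (T - {e}) = {connected_component_set (T - {e}) x}"
      proof (intro equalityI subsetI)
        fix X assume "X \<in> components (T - {e})"
        then obtain q where "q \<in> T - {e}" "X = connected_component_set (T - {e}) q"
          by (rule componentsE)
        then show "X \<in> {connected_component_set (T - {e}) x}" using eq by simp
      qed (use componentsI[OF x] in simp)
      then show ?thesis using e eT by (auto simp: endpoint_def global_arms_def)
    next
      case False
      then obtain q where q: "q \<in> T - {e}" "\<not> arc_joined (T - {e}) x q" by blast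
      \<comment> \<open>An arc from \<open>x\<close> into the arm of \<open>q\<close> must pass
        through \<open>e\<close>, so that arm lies on the same side of \<open>x\<close> as
        \<open>e\<close>.\<close>
      have *: "arc_joined (T - {x}) p d" if "arc_joined (T - {e}) q d" for d
      proof -
        have d: "\<not> arc_joined (T - {e}) x d"
          using that q(2) arc_joined_sym arc_joined_trans by metis
        have "d \<in> T" "d \<noteq> e" using that by (auto simp: arc_joined_def)
        moreover have "d \<noteq> x" using d less.prems eT by (auto simp: arc_joined_def)
        ultimately obtain D where D: "arc_between D x d" "D \<subseteq> T"
          using arc_exists[of x d] less.prems by metis
        then have "e \<in> D" using arc_joined_or_through d by blast
        then have "arc_joined (T - {x}) d e"
          using arc_joined_along[OF D] eT by blast
        then show ?thesis using e arc_joined_sym arc_joined_trans by blast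
      qed
      have "{v \<in> V. arc_joined (T - {e}) q v} \<subset> {v \<in> V. arc_joined (T - {x}) p v}"
        using * e by (auto simp: arc_joined_def)
      then have "card {v \<in> V. arc_joined (T - {e}) q v} < card {v \<in> V. arc_joined (T - {x}) p v}"
        using V by (intro psubset_card_mono) auto
      from less.hyps[OF this eT(1) q(1)] show ?thesis using * by blast
    qed
  qed
qed

text \<open>Representing an arm by an endpoint makes expansivity applicable later, as endpoints of a
  Hubbard tree lie on the critical orbit.\<close>

lemma local_armsE:
  assumes "L \<in> local_arms T x" "x \<in> T"
  obtains e where "L = local_arm_towards T x e" "endpoint T e" "e \<noteq> x"
proof -
  obtain p where p: "p \<in> T - {x}" "L = local_arm_towards T x p"
    using assms unfolding local_arm_towards_def local_arms_def global_arms_def components_def by auto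
  obtain e where e: "arc_joined (T - {x}) p e" "endpoint T e"
    using component_contains_endpoint[OF assms(2) p(1)] by blast
  then have "e \<noteq> x" by (auto simp: arc_joined_def)
  then show ?thesis using that e p local_arm_cong by metis
qed

section \<open>Locally injective paths in trees\<close>

text \<open>If the ends were the only coincidence, \<open>h\<close> would trace a simple closed
  curve on \<open>[s, t]\<close>.\<close>

lemma loop_free_interval:
  fixes h :: "real \<Rightarrow> 'a"
  assumes h: "continuous_on {s..t} h" "h ` {s..t} \<subseteq> T" "s < t" "h s = h t"
  shows "\<exists>u v. s \<le> u \<and> u < v \<and> v \<le> t \<and> h u = h v \<and> (u, v) \<noteq> (s, t)"
proof (rule ccontr)
  assume *: "\<not> ?thesis"
  let ?g = "\<lambda>u. h (s + u * (t - s))"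
  have "path ?g" "path_image ?g \<subseteq> T"
    unfolding path_def path_image_def using continuous_on_reparam[OF h(1)] h by auto
  moreover have "pathfinish ?g = pathstart ?g"
    using h by (simp add: pathstart_def pathfinish_def)
  moreover have "loop_free ?g"
  proof -
    have **: "a = b \<or> (a = 0 \<and> b = 1)"
      if "a \<in> {0..1}" "b \<in> {0..1}" "?g a = ?g b" "a \<le> b" for a b
    proof (rule ccontr)
      assume ab: "\<not> (a = b \<or> (a = 0 \<and> b = 1))"
      have "s + a * (t - s) \<in> {s..t}" "s + b * (t - s) \<in> {s..t}"
        using that h(3) affine_mem_Icc[of s t] by auto
      moreover have "s + a * (t - s) < s + b * (t - s)"
        using that ab h(3) by auto
      moreover have "(s + a * (t - s), s + b * (t - s)) \<noteq> (s, t)"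
      proof
        assume "(s + a * (t - s), s + b * (t - s)) = (s, t)"
        then have "a * (t - s) = 0" "(b - 1) * (t - s) = 0" by (auto simp: algebra_simps)
        then show False using ab h(3) by simp
      qed
      ultimately show False using * that(3) by (metis atLeastAtMost_iff)
    qed
    then show ?thesis unfolding loop_free_def by (metis linorder_linear)
  qed
  ultimately show False
    using tree unfolding tree_def simple_path_def by blast
qed

text \<open>A Lebesgue number \<open>d\<close> for the neighbourhoods of injectivity bounds the gap
  between parameters with equal images from below. So a closest such pair exists, but
  \<open>loop_free_interval\<close> yields a closer one.\<close>

lemma locally_injective_imp_injective:
  fixes h :: "real \<Rightarrow> 'a"
  assumes h: "continuous_on {0..1} h" "h ` {0..1} \<subseteq> T"
    and loc: "\<And>t. t \<in> {0..1} \<Longrightarrow> \<exists>U. open U \<and> t \<in> U \<and> inj_on h ({0..1} \<inter> U)"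
  shows "inj_on h {0..1}"
proof (rule ccontr)
  assume "\<not> inj_on h {0..1}"
  then obtain s0 t0 where st0: "s0 \<in> {0..1}" "t0 \<in> {0..1}" "s0 < t0" "h s0 = h t0"
    unfolding inj_on_def by (metis linorder_neqE_linordered_idom)
  obtain U where U: "\<And>t. t \<in> {0..1} \<Longrightarrow> open (U t)" "\<And>t. t \<in> {0..1} \<Longrightarrow> t \<in> U t"
    "\<And>t. t \<in> {0..1} \<Longrightarrow> inj_on h ({0..1} \<inter> U t)"
    using loc by metis
  obtain d where d: "d > 0" "\<And>t. t \<in> {0..1} \<Longrightarrow> \<exists>G \<in> U ` {0..1}. ball t d \<subseteq> G"
  proof (rule Heine_Borel_lemma[of "{0..1::real}" "U ` {0..1}"])
    show "{0..1} \<subseteq> \<Union>(U ` {0..1})" using U(2) by blast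
  qed (use U(1) in auto)
  have far: "d \<le> t - s" if "s \<in> {0..1}" "t \<in> {0..1}" "s < t" "h s = h t" for s t
  proof (rule ccontr)
    assume "\<not> d \<le> t - s"
    then have "s \<in> ball s d" "t \<in> ball s d" using d(1) that by (auto simp: dist_real_def)
    moreover have "\<exists>r\<in>{0..1}. ball s d \<subseteq> U r" using d(2)[OF that(1)] by auto
    then obtain r where "r \<in> {0..1}" "ball s d \<subseteq> U r" by blast
    ultimately have "s = t"
      using \<open>s \<in> {0..1}\<close> \<open>t \<in> {0..1}\<close> \<open>h s = h t\<close> by (intro inj_onD[OF U(3)[of r]]) auto
    then show False using that by simp
  qed
  \<comment> \<open>Two points at minimal distance with the same image bound a simple closed curve.\<close>
  define K where "K = {p \<in> {0..1} \<times> {0..1}. h (fst p) = h (snd p) \<and> d \<le> snd p - fst p}"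
  \<comment> \<open>The uniform gap allows the condition \<open>s < t\<close> to be replaced by a
    closed one, which makes \<open>K\<close> compact.\<close>
  have K: "p \<in> K \<longleftrightarrow> (\<exists>s t. p = (s, t) \<and> s \<in> {0..1} \<and> t \<in> {0..1} \<and> s < t \<and> h s = h t)" for p
    using far d(1) by (force simp: K_def)
  have "continuous_on ({0..1} \<times> {0..1}) (\<lambda>p::real\<times>real. (h (fst p), h (snd p)))"
    by (intro continuous_intros continuous_on_compose2[OF h(1)]) auto
  then have cl1: "closed (({0..1} \<times> {0..1}) \<inter> (\<lambda>p::real\<times>real. (h (fst p), h (snd p))) -` {y. \<exists>x. y = (x, x)})"
    by (intro continuous_closed_preimage closed_diagonal) (auto intro!: closed_Times)
  have cl2: "closed {p :: real \<times> real. d \<le> snd p - fst p}"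
    by (intro closed_Collect_le continuous_intros)
  have "compact (({0..1} \<times> {0..1}) \<inter> ((({0..1} \<times> {0..1}) \<inter>
      (\<lambda>p::real\<times>real. (h (fst p), h (snd p))) -` {y. \<exists>x. y = (x, x)}) \<inter> {p. d \<le> snd p - fst p}))"
    by (rule compact_Int_closed[OF compact_Times[OF compact_Icc compact_Icc] closed_Int[OF cl1 cl2]])
  also have "\<dots> = K" by (auto simp: K_def)
  finally have "compact K" .
  moreover have "K \<noteq> {}" using K st0 by blast
  moreover have "continuous_on K (\<lambda>p. snd p - fst p)" by (intro continuous_intros)
  ultimately obtain p where p: "p \<in> K" "\<And>q. q \<in> K \<Longrightarrow> snd p - fst p \<le> snd q - fst q"
    using continuous_attains_inf[of K "\<lambda>p. snd p - fst p"] by blast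
  then obtain s t where st: "p = (s, t)" "s \<in> {0..1}" "t \<in> {0..1}" "s < t" "h s = h t" using K by blast
  then have "continuous_on {s..t} h" "h ` {s..t} \<subseteq> T"
    using h by (auto intro!: continuous_on_subset[OF h(1)])
  from loop_free_interval[OF this st(4,5)]
  obtain u v where uv: "s \<le> u" "u < v" "v \<le> t" "h u = h v" "(u, v) \<noteq> (s, t)" by blast
  then have "(u, v) \<in> K" using K st by auto
  then have "t - s \<le> v - u" using p(2) st by fastforce
  then show False using uv by auto
qed

end

text \<open>A continuous injection of a compact set into a Hausdorff space is a homeomorphism onto
  its image, hence carries germs to germs.\<close>

lemma filtermap_at_within_arc:
  fixes f :: "'a::t2_space \<Rightarrow> 'b::t2_space"
  assumes "compact A" "continuous_on A f" "inj_on f A" "x \<in> A"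
  shows "filtermap f (at x within A) = at (f x) within f ` A"
proof (rule filter_eqI)
  fix P
  show "eventually P (filtermap f (at x within A)) \<longleftrightarrow> eventually P (at (f x) within f ` A)"
  proof
    assume "eventually P (at (f x) within f ` A)"
    then obtain W where W: "open W" "f x \<in> W" "\<And>z. z \<in> W \<Longrightarrow> z \<noteq> f x \<Longrightarrow> z \<in> f ` A \<Longrightarrow> P z"
      unfolding eventually_at_topological by blast
    obtain U where "open U" "f -` W \<inter> A = U \<inter> A"
      using assms(2) W(1) unfolding continuous_on_open_invariant by metis
    then have "x \<in> U" "\<forall>z\<in>U. z \<noteq> x \<longrightarrow> z \<in> A \<longrightarrow> P (f z)"
      using W assms(3,4) unfolding inj_on_def by blast+
    then show "eventually P (filtermap f (at x within A))"
      using \<open>open U\<close> unfolding eventually_filtermap eventually_at_topological by blast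
  next
    assume "eventually P (filtermap f (at x within A))"
    then obtain U where U: "open U" "x \<in> U" "\<And>z. z \<in> U \<Longrightarrow> z \<noteq> x \<Longrightarrow> z \<in> A \<Longrightarrow> P (f z)"
      unfolding eventually_filtermap eventually_at_topological by blast
    \<comment> \<open>The image of the part of \<open>A\<close> outside \<open>U\<close> is closed
      and misses \<open>f x\<close>; its complement is the required neighbourhood.\<close>
    have "compact (A \<inter> - U)" using assms(1) U(1) by (intro compact_Int_closed) auto
    then have "closed (f ` (A \<inter> - U))"
      by (intro compact_imp_closed compact_continuous_image continuous_on_subset[OF assms(2)]) auto
    moreover have "f x \<notin> f ` (A \<inter> - U)"
      using assms(3,4) U(2) unfolding inj_on_def by blast
    ultimately show "eventually P (at (f x) within f ` A)"
      unfolding eventually_at_topological using U(3)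
      by (intro exI[of _ "- f ` (A \<inter> - U)"]) blast
  qed
qed

section \<open>Dynamics on local arms\<close>

sublocale hubbard_tree \<subseteq> tree_space
  by unfold_locales (rule tree)

context hubbard_tree
begin

lemma f_in_T: "x \<in> T \<Longrightarrow> f x \<in> T"
  using surj by blast

section \<open>Injectivity of the map on arcs\<close>

lemma inj_on_arc_avoiding_crit:
  assumes A: "arc_between A x y" "A \<subseteq> T" "c0 \<notin> A"
  shows "inj_on f A"
proof -
  obtain g where g: "continuous_on {0..1::real} g" "inj_on g {0..1}" "g 0 = x" "g 1 = y" "A = g ` {0..1}"
    using A(1) by (rule arc_betweenE)
  have "inj_on (f \<circ> g) {0..1}"
  proof (rule locally_injective_imp_injective)
    show "continuous_on {0..1} (f \<circ> g)"
      using g A(2) by (intro continuous_on_compose continuous_on_subset[OF cont]) auto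
    show "(f \<circ> g) ` {0..1} \<subseteq> T"
      using g(5) A(2) f_in_T by auto
    show "\<exists>U. open U \<and> t \<in> U \<and> inj_on (f \<circ> g) ({0..1} \<inter> U)" if t: "t \<in> {0..1}" for t
    proof -
      have "g t \<in> T" "g t \<noteq> c0" using t g(5) A by auto
      then obtain U h where U: "openin (top_of_set T) U" "g t \<in> U" "homeomorphism U (f ` U) f h"
        using local_homeo[of "g t"] by blast
      have "inj_on f U" using homeomorphism_apply1[OF U(3)] by (metis inj_onI)
      obtain W where W: "open W" "U = T \<inter> W" using U(1) by (auto simp: openin_open)
      obtain V where V: "open V" "V \<inter> {0..1} = g -` W \<inter> {0..1}"
        using g(1) W(1) unfolding continuous_on_open_invariant by metis
      have "g t \<in> W" using U(2) W(2) by blast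
      then have "t \<in> V" using V(2) t by blast
      moreover have "inj_on (f \<circ> g) ({0..1} \<inter> V)"
      proof (rule comp_inj_on)
        show "inj_on g ({0..1} \<inter> V)" using g(2) by (rule inj_on_subset) auto
        have "g ` ({0..1} \<inter> V) \<subseteq> W" using V(2) by blast
        then have "g ` ({0..1} \<inter> V) \<subseteq> U" unfolding W(2) using g(5) A(2) by blast
        then show "inj_on f (g ` ({0..1} \<inter> V))" by (rule inj_on_subset[OF \<open>inj_on f U\<close>])
      qed
      ultimately show ?thesis using V(1) by blast
    qed
  qed
  then show ?thesis using g(5) by (simp add: inj_on_imageI)
qed

lemma inj_on_arc_to_crit:
  assumes A: "arc_between A x c0" "A \<subseteq> T"
  shows "inj_on f A"
proof -
  obtain g where g: "continuous_on {0..1::real} g" "inj_on g {0..1}" "g 0 = x" "g 1 = c0" "A = g ` {0..1}"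
    using A(1) by (rule arc_betweenE)
  let ?h = "f \<circ> g"
  have cont_h: "continuous_on {0..1} ?h"
    using g A(2) by (intro continuous_on_compose continuous_on_subset[OF cont]) auto
  have hT: "?h ` {0..1} \<subseteq> T" using g(5) A(2) f_in_T by auto
  have inj_below: "u = v" if "u \<in> {0..<1}" "v \<in> {0..<1}" "?h u = ?h v" for u v
  proof (rule ccontr)
    assume "u \<noteq> v"
    define r where "r = max u v"
    have r: "0 < r" "r < 1" using that \<open>u \<noteq> v\<close> by (auto simp: r_def)
    have arc: "arc_between (g ` {0..r}) x (g r)" using subarc[OF g(1,2), of 0 r] r g(3) by auto
    have "g ` {0..r} \<subseteq> T" using g(5) A(2) r by auto
    moreover have "c0 \<notin> g ` {0..r}"
    proof
      assume "c0 \<in> g ` {0..r}"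
      then obtain s where "s \<in> {0..r}" "g s = g 1" using g(4) by auto
      then show False using inj_onD[OF g(2), of s 1] r by auto
    qed
    ultimately have "inj_on f (g ` {0..r})" using inj_on_arc_avoiding_crit arc by blast
    moreover have "u \<in> {0..r}" "v \<in> {0..r}" using that by (auto simp: r_def)
    ultimately have "g u = g v" using that(3) by (auto dest: inj_onD)
    then show False using inj_onD[OF g(2), of u v] that \<open>u \<noteq> v\<close> by auto
  qed
  \<comment> \<open>A coincidence of \<open>s\<close> with the end produces another one,
    \<open>(u, v)\<close>, in \<open>[s, 1]\<close>. Both for \<open>v < 1\<close> and for
    \<open>v = 1\<close>, where \<open>u\<close> and \<open>s\<close> have the same image, this
    contradicts injectivity before the end.\<close>
  have last: "s = 1" if "s \<in> {0..1}" "?h s = ?h 1" for s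
  proof (rule ccontr)
    assume "s \<noteq> 1"
    then have "s < 1" using that by simp
    have c: "continuous_on {s..1} ?h"
      by (rule continuous_on_subset[OF cont_h]) (use that in auto)
    have T: "?h ` {s..1} \<subseteq> T" using that hT by auto
    from loop_free_interval[OF c T \<open>s < 1\<close> that(2)] obtain u v
      where uv: "s \<le> u" "u < v" "v \<le> 1" "?h u = ?h v" "(u, v) \<noteq> (s, 1)" by blast
    show False
    proof (cases "v = 1")
      case True
      then have "?h u = ?h s" using uv that by simp
      then have "u = s" using inj_below[of u s] uv that \<open>s < 1\<close> by auto
      then show False using uv True by simp
    next
      case False
      then show False using inj_below[of u v] uv that by auto
    qed
  qed
  have "inj_on ?h {0..1}"
  proof (rule inj_onI)
    fix u v :: real assume uv: "u \<in> {0..1}" "v \<in> {0..1}" "?h u = ?h v"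
    show "u = v"
    proof (cases "u = 1 \<or> v = 1")
      case True
      then show ?thesis using last[of u] last[of v] uv by metis
    next
      case False
      then show ?thesis using inj_below[of u v] uv by auto
    qed
  qed
  then show ?thesis using g(5) by (simp add: inj_on_imageI)
qed

section \<open>The action on local arms\<close>

lemma filtermap_local_arm_inj:
  assumes A: "arc_between A x y" "A \<subseteq> T" and inj: "inj_on f A"
  shows "arc_between (f ` A) (f x) (f y)" "f ` A \<subseteq> T"
    and "filtermap f (local_arm_towards T x y) = local_arm_towards T (f x) (f y)"
proof -
  have cA: "continuous_on A f" using cont A(2) continuous_on_subset by blast
  show a: "arc_between (f ` A) (f x) (f y)" using arc_between_image[OF A(1) cA inj] .
  show T: "f ` A \<subseteq> T" using A(2) f_in_T by blast
  show "filtermap f (local_arm_towards T x y) = local_arm_towards T (f x) (f y)"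
    using filtermap_at_within_arc[OF arc_between_compact[OF A(1)] cA inj] arc_between_mem[OF A(1)]
      local_arm_eq_at_within[OF A] local_arm_eq_at_within[OF a T] by simp
qed

text \<open>The germ at \<open>x\<close> sees only the part of the arc up to \<open>c0\<close>, and
  there \<open>f\<close> is injective.\<close>

lemma filtermap_local_arm_through_crit:
  assumes A: "arc_between A x y" "A \<subseteq> T" and c0: "c0 \<in> A" "x \<noteq> c0"
  shows "filtermap f (local_arm_towards T x y) = local_arm_towards T (f x) (f c0)" "f x \<noteq> f c0"
proof -
  obtain A' where A': "arc_between A' x c0" "A' \<subseteq> A"
    using arc_between_sub[OF A(1) c0(1)] c0(2) by metis
  have T: "A' \<subseteq> T" using A' A(2) by blast
  show "filtermap f (local_arm_towards T x y) = local_arm_towards T (f x) (f c0)"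
    using filtermap_local_arm_inj(3)[OF A'(1) T inj_on_arc_to_crit[OF A'(1) T]]
      local_arm_along[OF A c0(1)] c0(2) by simp
  show "f x \<noteq> f c0"
    using filtermap_local_arm_inj(1)[OF A'(1) T inj_on_arc_to_crit[OF A'(1) T]] arc_between_mem by blast
qed

lemma filtermap_local_arm_cases:
  assumes "x \<in> T" "x \<noteq> c0" "y \<in> T" "y \<noteq> x"
  obtains y' where "y' = f y \<or> y' = f c0" "y' \<noteq> f x"
    "filtermap f (local_arm_towards T x y) = local_arm_towards T (f x) y'"
proof -
  obtain A where A: "arc_between A x y" "A \<subseteq> T" using arc_exists assms by metis
  show ?thesis
  proof (cases "c0 \<in> A")
    case True
    then show ?thesis using filtermap_local_arm_through_crit[OF A True] assms(2) that[of "f c0"] by metis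
  next
    case False
    note * = filtermap_local_arm_inj[OF A inj_on_arc_avoiding_crit[OF A False]]
    show ?thesis using that[of "f y"] *(3) arc_between_mem[OF *(1)] by metis
  qed
qed

lemma filtermap_local_arms:
  assumes "x \<in> T" "x \<noteq> c0" "L \<in> local_arms T x"
  shows "filtermap f L \<in> local_arms T (f x)"
proof -
  obtain e where e: "L = local_arm_towards T x e" "endpoint T e" "e \<noteq> x"
    using local_armsE assms by metis
  then have "e \<in> T" by (simp add: endpoint_def)
  then obtain y' where "y' = f e \<or> y' = f c0" "y' \<noteq> f x"
    "filtermap f (local_arm_towards T x e) = local_arm_towards T (f x) y'"
    using filtermap_local_arm_cases[OF assms(1,2)] e by metis
  then show ?thesis
    using e local_arm_towards_in_local_arms[of y' "f x"] f_in_T \<open>e \<in> T\<close> crit_in by auto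
qed

lemma arc_shrink:
  assumes A: "arc_between A x y" and U: "open U" "x \<in> U"
  obtains A' w where "arc_between A' x w" "A' \<subseteq> A \<inter> U"
proof -
  obtain g where g: "continuous_on {0..1::real} g" "inj_on g {0..1}" "g 0 = x" "g 1 = y" "A = g ` {0..1}"
    using A by (rule arc_betweenE)
  obtain V where V: "open V" "V \<inter> {0..1} = g -` U \<inter> {0..1}"
    using g(1) U(1) unfolding continuous_on_open_invariant by metis
  have "0 \<in> g -` U \<inter> {0..1}" using g(3) U(2) by simp
  then have "0 \<in> V" using V(2) by blast
  then obtain d where d: "d > 0" "ball 0 d \<subseteq> V" using V(1) openE by blast
  define r where "r = min 1 (d / 2)"
  have r: "0 < r" "r \<le> 1" "r < d" using d(1) by (auto simp: r_def)
  have "g ` {0..r} \<subseteq> U"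
  proof (rule image_subsetI)
    fix t assume "t \<in> {0..r}"
    then have "t \<in> V \<inter> {0..1}" using r d(2) by (auto simp: dist_real_def)
    then show "g t \<in> U" using V(2) by blast
  qed
  moreover have "g ` {0..r} \<subseteq> A" using g(5) r by auto
  ultimately show ?thesis
    using that[of "g ` {0..r}" "g r"] subarc[OF g(1,2), of 0 r] r g(3) by auto
qed

text \<open>Take arcs into both arms within a neighbourhood where \<open>f\<close> is injective.
  Equal image germs are nontrivial, so the images of the arcs meet off \<open>f x\<close>; hence the
  arcs share a point other than \<open>x\<close>, which determines the arm.\<close>

lemma inj_on_filtermap_local_arms:
  assumes x: "x \<in> T" "x \<noteq> c0"
  shows "inj_on (filtermap f) (local_arms T x)"
proof (rule inj_onI)
  fix L1 L2 assume L: "L1 \<in> local_arms T x" "L2 \<in> local_arms T x" "filtermap f L1 = filtermap f L2"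
  obtain e1 where e1: "L1 = local_arm_towards T x e1" "endpoint T e1" "e1 \<noteq> x"
    using local_armsE[OF L(1) x(1)] .
  obtain e2 where e2: "L2 = local_arm_towards T x e2" "endpoint T e2" "e2 \<noteq> x"
    using local_armsE[OF L(2) x(1)] .
  have eT: "e1 \<in> T" "e2 \<in> T" using e1 e2 by (auto simp: endpoint_def)
  obtain A1 where A1: "arc_between A1 x e1" "A1 \<subseteq> T" using arc_exists x eT e1 by metis
  obtain A2 where A2: "arc_between A2 x e2" "A2 \<subseteq> T" using arc_exists x eT e2 by metis
  obtain U h where U: "openin (top_of_set T) U" "x \<in> U" "homeomorphism U (f ` U) f h"
    using local_homeo[OF x] by blast
  have injU: "inj_on f U" using homeomorphism_apply1[OF U(3)] by (metis inj_onI)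
  obtain W where W: "open W" "U = T \<inter> W" using U(1) by (auto simp: openin_open)
  obtain B1 w1 where B1: "arc_between B1 x w1" "B1 \<subseteq> A1 \<inter> W"
    using arc_shrink[OF A1(1) W(1)] W U by blast
  obtain B2 w2 where B2: "arc_between B2 x w2" "B2 \<subseteq> A2 \<inter> W"
    using arc_shrink[OF A2(1) W(1)] W U by blast
  have "w1 \<in> A1" "w2 \<in> A2" "w1 \<noteq> x" "w2 \<noteq> x"
    using B1(2) B2(2) arc_between_mem[OF B1(1)] arc_between_mem[OF B2(1)] by auto
  then have L1: "L1 = local_arm_towards T x w1" and L2: "L2 = local_arm_towards T x w2"
    using e1 e2 local_arm_along A1 A2 by metis+
  have BT: "B1 \<subseteq> T" "B2 \<subseteq> T" using A1 A2 B1 B2 by auto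
  have ev1: "eventually (\<lambda>z. z \<in> f ` (B1 - {x})) (filtermap f L1)"
    unfolding L1 local_arm_eq_at_within[OF B1(1) BT(1)] eventually_filtermap
    by (auto simp: eventually_at_filter)
  have ev2: "eventually (\<lambda>z. z \<in> f ` (B2 - {x})) (filtermap f L2)"
    unfolding L2 local_arm_eq_at_within[OF B2(1) BT(2)] eventually_filtermap
    by (auto simp: eventually_at_filter)
  have "filtermap f L1 \<noteq> bot"
    unfolding L1 filtermap_bot_iff using local_arm_neq_bot x \<open>w1 \<noteq> x\<close> arc_between_mem[OF B1(1)] BT by blast
  moreover have "eventually (\<lambda>z. z \<in> f ` (B1 - {x}) \<and> z \<in> f ` (B2 - {x})) (filtermap f L1)"
    using ev1 ev2 L(3) by (simp add: eventually_conj)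
  ultimately obtain z where z: "z \<in> f ` (B1 - {x})" "z \<in> f ` (B2 - {x})"
    using eventually_happens' by blast
  then obtain p q where pq: "p \<in> B1 - {x}" "q \<in> B2 - {x}" "f p = f q" by auto
  have "B1 \<subseteq> U" "B2 \<subseteq> U" unfolding W(2) using B1(2) B2(2) BT by blast+
  then have "p \<in> U" "q \<in> U" using pq by blast+
  then have "p = q" by (rule inj_onD[OF injU pq(3)])
  then show "L1 = L2"
    using pq L1 L2 local_arm_along[OF B1(1) BT(1), of p] local_arm_along[OF B2(1) BT(2), of p] by auto
qed

text \<open>Expansivity makes the arc to an endpoint in the arm cover \<open>c0\<close> at some
  first time \<open>k\<close>. Up to then the arc is mapped injectively and the arm follows its end;
  one step later, the arm points to the critical value.\<close>

lemma eventually_points_to_critical_value: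
  assumes z: "branch_point T z" and orb: "\<And>k. (f ^^ k) z \<noteq> c0" and L: "L \<in> local_arms T z"
  obtains k where "(filtermap f ^^ Suc k) L = local_arm_towards T ((f ^^ Suc k) z) (f c0)"
    "(f ^^ Suc k) z \<noteq> f c0"
proof -
  have zT: "z \<in> T" using z by (simp add: branch_point_def)
  obtain e where e: "L = local_arm_towards T z e" "endpoint T e" "e \<noteq> z"
    using local_armsE[OF L zT] .
  then have eT: "e \<in> T" by (simp add: endpoint_def)
  obtain A where A: "arc_between A z e" "A \<subseteq> T" using arc_exists zT eT e(3) by metis
  have "\<exists>n. c0 \<in> (f ^^ n) ` A"
    using expansive[of z e] e endpoints z closed_arc_eq[OF A] by auto
  then obtain k where k: "c0 \<in> (f ^^ k) ` A" "\<And>j. j < k \<Longrightarrow> c0 \<notin> (f ^^ j) ` A"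
    using exists_least_iff[of "\<lambda>n. c0 \<in> (f ^^ n) ` A"] by blast
  \<comment> \<open>The range includes \<open>j = k\<close>: the step from \<open>j\<close> to
    \<open>Suc j\<close> only needs that the image at time \<open>j\<close> misses
    \<open>c0\<close>.\<close>
  have "arc_between ((f ^^ j) ` A) ((f ^^ j) z) ((f ^^ j) e) \<and> (f ^^ j) ` A \<subseteq> T \<and>
      (filtermap f ^^ j) L = local_arm_towards T ((f ^^ j) z) ((f ^^ j) e)" if "j \<le> k" for j
    using that
  proof (induction j)
    case 0
    then show ?case using A e by simp
  next
    case (Suc j)
    then have IH: "arc_between ((f ^^ j) ` A) ((f ^^ j) z) ((f ^^ j) e)" "(f ^^ j) ` A \<subseteq> T"
      "(filtermap f ^^ j) L = local_arm_towards T ((f ^^ j) z) ((f ^^ j) e)" by auto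
    note * = filtermap_local_arm_inj[OF IH(1,2) inj_on_arc_avoiding_crit[OF IH(1,2)]]
    have "c0 \<notin> (f ^^ j) ` A" using k(2) Suc.prems by simp
    then show ?case using * IH(3) by (simp add: image_image)
  qed
  then have *: "arc_between ((f ^^ k) ` A) ((f ^^ k) z) ((f ^^ k) e)" "(f ^^ k) ` A \<subseteq> T"
      "(filtermap f ^^ k) L = local_arm_towards T ((f ^^ k) z) ((f ^^ k) e)" by auto
  show ?thesis
    using filtermap_local_arm_through_crit[OF *(1,2) k(1) orb] *(3) that[of k] by simp
qed

end

section \<open>Iterates and cyclic permutations\<close>

lemma funpow_filtermap:
  fixes f :: "'a \<Rightarrow> 'a"
  shows "filtermap f ^^ k = filtermap (f ^^ k)"
proof (induction k)
  case 0
  then show ?case by (simp add: fun_eq_iff id_def filtermap_ident)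
next
  case (Suc k)
  show ?case unfolding funpow.simps Suc by (simp add: fun_eq_iff filtermap_filtermap o_def)
qed

text \<open>On a finite set every point lies on a cycle. As \<open>b\<close> reaches
  \<open>c\<close>, the point \<open>c\<close> lies on the cycle of \<open>b\<close> and leads back
  to \<open>b\<close>; so \<open>a\<close> reaches \<open>b\<close> by way of
  \<open>c\<close>.\<close>

lemma permutes_transitivelyI:
  fixes \<phi> :: "'b \<Rightarrow> 'b"
  assumes fin: "finite X" and bij: "bij_betw \<phi> X X" and reach: "\<And>a. a \<in> X \<Longrightarrow> \<exists>k. (\<phi> ^^ k) a = c"
  shows "permutes_transitively \<phi> X"
  unfolding permutes_transitively_def
proof (intro conjI ballI bij)
  fix a b assume ab: "a \<in> X" "b \<in> X"
  have maps: "(\<phi> ^^ k) x \<in> X" if "x \<in> X" for k x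
    using that bij by (induction k) (auto dest: bij_betwE)
  have inj: "inj_on (\<phi> ^^ k) X" for k
  proof (induction k)
    case (Suc k)
    have "inj_on \<phi> ((\<phi> ^^ k) ` X)"
      using bij_betw_imp_inj_on[OF bij] by (rule inj_on_subset) (use maps in auto)
    with Suc show ?case unfolding funpow.simps by (rule comp_inj_on)
  qed simp
  have "\<not> inj_on (\<lambda>k. (\<phi> ^^ k) b) (UNIV :: nat set)"
    using maps[OF ab(2)] fin by (metis finite_imageD finite_subset image_subsetI infinite_UNIV_nat)
  then obtain i j where ij: "i < j" "(\<phi> ^^ i) b = (\<phi> ^^ j) b"
    unfolding inj_on_def by (metis linorder_neqE_nat)
  then have "(\<phi> ^^ i) b = (\<phi> ^^ i) ((\<phi> ^^ (j - i)) b)"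
    by (metis funpow_add comp_apply le_add_diff_inverse less_imp_le)
  then have per: "(\<phi> ^^ (j - i)) b = b"
    using inj_onD[OF inj] maps ab(2) by metis
  have per': "(\<phi> ^^ (m * (j - i))) b = b" for m
    by (induction m) (simp_all add: funpow_add per)
  obtain k l where kl: "(\<phi> ^^ k) a = c" "(\<phi> ^^ l) b = c" using reach ab by metis
  \<comment> \<open>\<open>l * (j - i)\<close> is a multiple of a period of \<open>b\<close> and at
    least \<open>l\<close>; the remaining iterates lead from \<open>c\<close> back to
    \<open>b\<close>.\<close>
  have "l * 1 \<le> l * (j - i)" using ij(1) by (intro mult_le_mono2) simp
  then have "l \<le> l * (j - i)" by simp
  then have "(\<phi> ^^ (l * (j - i) - l)) ((\<phi> ^^ l) b) = b"
    using per'[of l] by (metis funpow_add comp_apply le_add_diff_inverse2)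
  then have "(\<phi> ^^ (l * (j - i) - l + k)) a = b"
    using kl by (simp add: funpow_add)
  then show "\<exists>k. (\<phi> ^^ k) a = b" by blast
qed

section \<open>The first return map at the characteristic point\<close>

theorem corollary3p4:
  fixes T :: "'a::t2_space set" and f :: "'a \<Rightarrow> 'a" and c0 z1 :: 'a and n :: nat
  assumes "hubbard_tree T f c0"
    and "exact_period f z1 n"
    and "\<forall>z \<in> forward_orbit f z1. branch_point T z"
    and "characteristic_point T f c0 (forward_orbit f z1) z1"
  shows "permutes_transitively (filtermap (f ^^ n)) (local_arms T z1) \<or>
         (filtermap (f ^^ n) (local_arm_towards T z1 c0) = local_arm_towards T z1 c0 \<and>
          permutes_transitively (filtermap (f ^^ n))
            (local_arms T z1 - {local_arm_towards T z1 c0}))"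
proof -
  interpret hubbard_tree T f c0 by fact
  define Z where "Z = forward_orbit f z1"
  have n: "n > 0" "(f ^^ n) z1 = z1" and minimal: "\<And>m. 0 < m \<Longrightarrow> m < n \<Longrightarrow> (f ^^ m) z1 \<noteq> z1"
    using assms(2) by (auto simp: exact_period_def)
  have Z: "(f ^^ k) z1 \<in> Z" for k by (auto simp: Z_def forward_orbit_def)
  have fZ: "f w \<in> Z" if "w \<in> Z" for w
    using that Z[of "Suc k" for k] unfolding Z_def forward_orbit_def by auto
  have branch: "branch_point T w" if "w \<in> Z" for w using assms(3) that by (simp add: Z_def)
  have ZT: "w \<in> T" if "w \<in> Z" for w using branch[OF that] by (simp add: branch_point_def)
  have z1: "z1 \<in> Z" "z1 \<in> T" using Z[of 0] ZT[of z1] by auto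
  obtain A B where A: "A \<in> components (T - {z1})" "f c0 \<in> A"
    and B: "B \<in> components (T - {z1})" "c0 \<in> B" "Z - {z1} \<subseteq> B" and "A \<noteq> B"
    using assms(4) unfolding characteristic_point_def Z_def[symmetric] by blast
  have AB: "A \<inter> B = {}" using components_nonoverlap A B \<open>A \<noteq> B\<close> by blast
  have sub: "A \<subseteq> T - {z1}" "B \<subseteq> T - {z1}" using A B in_components_subset by blast+
  have c: "c0 \<in> T" "c0 \<noteq> z1" "f c0 \<in> T" "f c0 \<noteq> z1" using sub A B by auto
  have joined_B: "arc_joined (T - {z1}) p q" if "p \<in> B" "q \<in> B" for p q
    using that B(1) connected_component_iff
    by (metis connected_component_def in_components_connected sub(2))
  have separated: "\<not> arc_joined (T - {z1}) w (f c0)" if "w \<in> B" for w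
  proof
    assume "arc_joined (T - {z1}) w (f c0)"
    then have "f c0 \<in> connected_component_set (T - {z1}) w"
      by (simp add: connected_component_iff)
    also have "\<dots> = B" using B(1) that by (metis connected_component_eq componentsE)
    finally show False using A AB by blast
  qed
  \<comment> \<open>The orbit lies in \<open>B\<close> apart from \<open>z1\<close>, while the
    critical value lies in \<open>A\<close>. By invariance of the orbit, \<open>c0\<close> is not on
    it either, so the lemmas for noncritical points apply all along the orbit.\<close>
  have cZ: "f c0 \<notin> Z"
    using A(2) B(3) AB c(4) by blast
  have c0Z: "c0 \<notin> Z" using fZ cZ by blast
  have orbit_nc: "(f ^^ k) z1 \<noteq> c0" for k using c0Z Z by metis
  define a0 where "a0 = local_arm_towards T z1 c0"
  define a1 where "a1 = local_arm_towards T z1 (f c0)"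
  have arm_Z: "local_arm_towards T z1 w = a0" if "w \<in> Z" "w \<noteq> z1" for w
    unfolding a0_def using that B by (intro local_arm_cong joined_B) auto

  \<comment> \<open>Here \<open>d\<close> is the time of first arrival at \<open>z1\<close>: the arm
    can be redirected towards \<open>z1\<close> only at other points of the orbit.\<close>
  have transport: "(filtermap f ^^ d) (local_arm_towards T w y) \<in> {a0, a1}"
    if "w \<in> Z" "y \<in> insert (f c0) Z" "y \<noteq> w" "(f ^^ d) w = z1" "\<And>i. i < d \<Longrightarrow> (f ^^ i) w \<noteq> z1" for d w y
    using that
  proof (induction d arbitrary: w y)
    case 0
    then show ?case using arm_Z[of y] by (auto simp: a1_def)
  next
    case (Suc d)
    have wz: "w \<noteq> z1" using Suc.prems(5)[of 0] by simp
    have w: "w \<in> T" "w \<noteq> c0" using ZT Suc.prems(1) c0Z by auto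
    \<comment> \<open>A target \<open>f c0\<close> is replaced by \<open>z1\<close>, which lies
      between it and \<open>w\<close>. The target is then on the orbit, and so is its image.\<close>
    obtain y2 where y2: "y2 \<in> Z" "y2 \<noteq> w" "local_arm_towards T w y = local_arm_towards T w y2"
    proof (cases "y = f c0")
      case True
      have "w \<in> B" using Suc.prems(1) wz B by auto
      obtain D where D: "arc_between D w (f c0)" "D \<subseteq> T"
        using arc_exists[of w "f c0"] w c Suc.prems(3) True by metis
      have "z1 \<in> D" using arc_joined_or_through[OF D separated[OF \<open>w \<in> B\<close>]] .
      then have "local_arm_towards T w z1 = local_arm_towards T w y"
        using local_arm_along[OF D] wz True by blast
      then show ?thesis using that[of z1] z1 wz by simp
    next
      case False
      then show ?thesis using that[of y] Suc.prems by auto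
    qed
    obtain y' where y': "y' = f y2 \<or> y' = f c0" "y' \<noteq> f w"
      "filtermap f (local_arm_towards T w y2) = local_arm_towards T (f w) y'"
      using filtermap_local_arm_cases[OF w ZT[OF y2(1)] y2(2)] by metis
    have "(filtermap f ^^ d) (local_arm_towards T (f w) y') \<in> {a0, a1}"
    proof (rule Suc.IH)
      show "f w \<in> Z" "y' \<in> insert (f c0) Z" "y' \<noteq> f w" using fZ Suc.prems(1) y2 y' by auto
      show "(f ^^ d) (f w) = z1" using Suc.prems(4) by (simp add: funpow_swap1)
      show "(f ^^ i) (f w) \<noteq> z1" if "i < d" for i
        using Suc.prems(5)[of "Suc i"] that by (simp add: funpow_swap1)
    qed
    then show ?case using y2 y' by (simp add: funpow_swap1)
  qed

  define \<phi> where "\<phi> = filtermap (f ^^ n)"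
  have \<phi>: "\<phi> = filtermap f ^^ n" by (simp add: \<phi>_def funpow_filtermap)
  define X where "X = local_arms T z1"
  have a0X: "a0 \<in> X" using local_arm_towards_in_local_arms c by (auto simp: a0_def X_def)

  \<comment> \<open>One application of \<open>f\<close> turns \<open>a0\<close> into the arm at
    \<open>f z1\<close> towards the critical value; \<open>transport\<close> covers the remaining
    \<open>n - 1\<close> steps, since exactness of the period excludes earlier returns.\<close>
  have "\<phi> a0 \<in> {a0, a1}"
  proof -
    obtain D where D: "arc_between D z1 c0" "D \<subseteq> T" using arc_exists[of z1 c0] z1 c by metis
    have "filtermap f a0 = local_arm_towards T (f z1) (f c0)" "f z1 \<noteq> f c0"
      using filtermap_local_arm_through_crit[OF D] arc_between_mem[OF D(1)] c(2) by (auto simp: a0_def)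
    moreover have "(filtermap f ^^ (n - 1)) (local_arm_towards T (f z1) (f c0)) \<in> {a0, a1}"
    proof (rule transport)
      show "(f ^^ (n - 1)) (f z1) = z1" using n by (cases n) (auto simp: funpow_swap1)
      show "(f ^^ i) (f z1) \<noteq> z1" if "i < n - 1" for i
        using minimal[of "Suc i"] that by (auto simp: funpow_swap1)
    qed (use fZ z1 \<open>f z1 \<noteq> f c0\<close> in auto)
    ultimately show ?thesis using n(1) unfolding \<phi> by (cases n) (auto simp: funpow_swap1)
  qed
  \<comment> \<open>Wait until the arm points to the critical value, then until the orbit next
    visits \<open>z1\<close>. The total time is a multiple of \<open>n\<close>, hence a number of
    iterations of \<open>\<phi>\<close>.\<close>
  have reach: "\<exists>k. (\<phi> ^^ k) L \<in> {a0, a1}" if L: "L \<in> X" for L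
  proof -
    obtain k where k: "(filtermap f ^^ Suc k) L = local_arm_towards T ((f ^^ Suc k) z1) (f c0)"
      "(f ^^ Suc k) z1 \<noteq> f c0"
      using eventually_points_to_critical_value[OF branch[OF z1(1)] orbit_nc] L unfolding X_def by metis
    \<comment> \<open>\<open>Suc k * n\<close> is a multiple of the period not below
      \<open>Suc k\<close>, so a visit to \<open>z1\<close> does occur.\<close>
    have "(f ^^ (Suc k * n - Suc k)) ((f ^^ Suc k) z1) = (f ^^ (Suc k * n)) z1"
      using n(1) by (metis comp_apply funpow_add le_add_diff_inverse2 mult_le_mono2 mult.right_neutral Suc_leI One_nat_def)
    also have "\<dots> = z1" using funpow_mod_eq[OF n(2), of "Suc k * n"] by simp
    finally obtain d where d: "(f ^^ d) ((f ^^ Suc k) z1) = z1"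
      "\<And>i. i < d \<Longrightarrow> (f ^^ i) ((f ^^ Suc k) z1) \<noteq> z1"
      using exists_least_iff[of "\<lambda>d. (f ^^ d) ((f ^^ Suc k) z1) = z1"] by blast
    have "(f ^^ (d + Suc k)) z1 = z1" using d(1) by (metis comp_apply funpow_add)
    then have "(d + Suc k) mod n = 0"
      using funpow_mod_eq[OF n(2), of "d + Suc k"] minimal[of "(d + Suc k) mod n"] n(1) by fastforce
    then obtain q where q: "d + Suc k = n * q" by blast
    have "(filtermap f ^^ d) ((filtermap f ^^ Suc k) L) \<in> {a0, a1}"
      unfolding k(1) by (rule transport[OF Z _ _ d]) (use k(2) in auto)
    then have "(filtermap f ^^ (n * q)) L \<in> {a0, a1}" by (metis comp_apply funpow_add q)
    then show ?thesis unfolding \<phi> funpow_mult by blast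
  qed

  \<comment> \<open>An infinite set has \<open>card\<close> equal to 0, so having at least three
    arms in the sense of \<open>card\<close> implies finiteness.\<close>
  have "finite (global_arms T z1)"
    using branch[OF z1(1)] by (intro card_ge_0_finite) (simp add: branch_point_def)
  then have fin: "finite X" by (simp add: X_def local_arms_def)
  \<comment> \<open>The base point moves along the orbit; the second conjunct keeps the images among
    its arms, where one more step is injective.\<close>
  have "inj_on (filtermap f ^^ j) X \<and> (filtermap f ^^ j) ` X \<subseteq> local_arms T ((f ^^ j) z1)" for j
  proof (induction j)
    case (Suc j)
    have "inj_on (filtermap f) ((filtermap f ^^ j) ` X)"
      using inj_on_filtermap_local_arms[OF ZT[OF Z] orbit_nc] Suc inj_on_subset by blast
    then have "inj_on (filtermap f ^^ Suc j) X"
      unfolding funpow.simps using Suc by (intro comp_inj_on) auto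
    moreover have "(filtermap f ^^ Suc j) ` X \<subseteq> local_arms T ((f ^^ Suc j) z1)"
      using filtermap_local_arms[OF ZT[OF Z] orbit_nc] Suc by fastforce
    ultimately show ?case ..
  qed (simp add: X_def)
  from this[of n] have inj: "inj_on \<phi> X" and "\<phi> ` X \<subseteq> X" using n(2) by (auto simp: \<phi> X_def)
  then have surj: "\<phi> ` X = X" using endo_inj_surj[OF fin] by blast
  have bij: "bij_betw \<phi> X X" using inj surj by (simp add: bij_betw_def)

  show ?thesis
  proof (cases "\<phi> a0 = a0")
    case True
    have "bij_betw \<phi> (X - {a0}) (X - {a0})"
    proof (rule bij_betw_imageI)
      show "inj_on \<phi> (X - {a0})" using inj by (rule inj_on_subset) auto
      show "\<phi> ` (X - {a0}) = X - {a0}" using inj_on_image_set_diff[OF inj, of X "{a0}"] surj True a0X by auto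
    qed
    \<comment> \<open>The iterates of \<open>L\<close> never meet the fixed arm \<open>a0\<close>,
      so they must reach \<open>a1\<close>.\<close>
    moreover have "\<exists>k. (\<phi> ^^ k) L = a1" if L: "L \<in> X - {a0}" for L
    proof -
      have "(\<phi> ^^ k) L \<in> X - {a0}" for k
        using L bij_betwE[OF \<open>bij_betw \<phi> (X - {a0}) (X - {a0})\<close>] by (induction k) auto
      then show ?thesis using reach[of L] L by blast
    qed
    ultimately have "permutes_transitively \<phi> (X - {a0})"
      using fin by (intro permutes_transitivelyI[where c = a1]) auto
    then show ?thesis using True by (simp add: \<phi>_def X_def a0_def)
  next
    case False
    then have "\<phi> a0 = a1" using \<open>\<phi> a0 \<in> {a0, a1}\<close> by blast
    \<comment> \<open>An arm that reaches \<open>a0\<close> is at \<open>a1\<close> one step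
      later.\<close>
    then have "\<exists>k. (\<phi> ^^ k) L = a1" if "L \<in> X" for L
      using reach[OF that] by (metis empty_iff funpow.simps(2) comp_apply insertE)
    then have "permutes_transitively \<phi> X"
      using fin bij by (intro permutes_transitivelyI[where c = a1]) auto
    then show ?thesis by (simp add: \<phi>_def X_def)
  qed
qed

end
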